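(* For every $n\geq0$, the basis $\{v_\alpha:\alpha\in\mathcal{E}_q(n)\}$ of $\mathbb{C}[B_q(n)]$ is orthogonal with respect to the inner product $\langle u,v\rangle_n=\sum_{X\in B_q(n)}\overline{u(X)}\,v(X)\,\dfrac{q^{\binom{\dim X}{2}}}{P_q(n)}$, where $P_q(n)=\prod_{i=0}^{n-1}(1+q^i)$.
   Context: $q$ is a prime power. For $m\geq 0$, $\mathbb{F}_q^m$ is the space of column vectors of length $m$ over $\mathbb{F}_q$ with standard basis $e_1,\dots,e_m$; for $k<m$, $\mathbb{F}_q^k$ is identified with the subspace of vectors whose last $m-k$ coordinates vanish. $B_q(m)$ is the set of subspaces of $\mathbb{F}_q^m$; $B_q(X)$ is the set of subspaces of a space $X$. $\mathbb{C}[S]$ is the complex vector space with basis $S$, and for $v=\sum_Y v(Y)Y$ the numbers $v(Y)$ are its coordinates; $\mathbb{C}[B_q(m)]\subseteq\mathbb{C}[B_q(m+1)]$. Construction. Let $n\geq0$. $A_q(n+1)=\{Y\in B_q(n+1):Y\not\subseteq\mathbb{F}_q^n\}$. $\theta_n:\mathbb{C}[B_q(n)]\to\mathbb{C}[B_q(n+1)]$ is linear with $\theta_n(Z)=\sum Y$ over all $Y\in A_q(n+1)$ with $Y\cap\mathbb{F}_q^n=Z$. For $Z\in B_q(n)$, $\widehat Z$ is the span of $Z$ and $e_{n+1}$. $H(n+1,\mathbb{F}_q)$ is the group of matrices $\begin{pmatrix}I_n&a\\0&1\end{pmatrix}$, $a\in\mathbb{F}_q^n$, acting on $A_q(n+1)$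 by $Y\mapsto gY$ and linearly on $\mathbb{C}[A_q(n+1)]$. $\mathcal{N}_q(n)$ is the set of nontrivial homomorphisms $\chi:H(n+1,\mathbb{F}_q)\to\mathbb{C}^*$, and $p(\chi)(v)=\sum_g\overline{\chi(g)}\,gv$. It is a fact that for $n\geq1$, $\chi\in\mathcal{N}_q(n)$ there is a unique $(n-1)$-dimensional $X(\chi)\subseteq\mathbb{F}_q^n$ with $p(\chi)(\widehat{X(\chi)})\neq0$; $\lambda(\chi):\mathbb{C}[B_q(X(\chi))]\to\mathbb{C}[B_q(n+1)]$ is linear with $Y\mapsto q^{-\dim Y}p(\chi)(\widehat Y)$. For an $(n-1)$-dimensional $X\subseteq\mathbb{F}_q^n$, $M(X)$ is the unique $n\times(n-1)$ matrix in Schubert normal form (every column nonzero; last nonzero entry of column $j$ is $1$, in row $r_j$; $r_1<\dots<r_{n-1}$; rows $r_1,\dots,r_{n-1}$ form the identity) with column space $X$; $\tau(X):\mathbb{F}_q^{n-1}\to X$ sends $e_j$ to column $j$ of $M(X)$; $\mu(X):\mathbb{C}[B_q(n-1)]\to\mathbb{C}[B_q(X)]$ is $Y\mapsto\tau(X)(Y)$. Index sets: $\mathcal{E}_q(0)=\{()\}$, $\mathcal{E}_q(1)=\{(0),(1)\}$, and for $n\geq2$, $\mathcal{E}_q(n)$ consists of the sequences $(\beta,0),(\beta,1)$ with $\beta\in\mathcal{E}_q(n-1)$ together with the sequences $(\beta,\chi)$ with $\beta\in\mathcal{E}_q(n-2)$, $\chi\in\mathcal{N}_q(n-1)$. $N(\alpha)$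 is the number of entries of $\alpha$ not equal to $0$. Vectors: $v_{()}=\{0\}$, $v_{(0)}=\{0\}+\mathbb{F}_q$, $v_{(1)}=\{0\}-\mathbb{F}_q$. For $n\geq1$ and $\alpha=(\beta,a)\in\mathcal{E}_q(n+1)$ with $k=N(\beta)$: if $a=0$, $v_\alpha=q^kv_\beta+\theta_n(v_\beta)$; if $a=1$, $v_\alpha=q^{n-k}v_\beta-\theta_n(v_\beta)$; if $a=\chi\in\mathcal{N}_q(n)$ (so $\beta\in\mathcal{E}_q(n-1)$), $v_\alpha=\lambda(\chi)\big(\mu(X(\chi))(v_\beta)\big)$. It is known that $\{v_\alpha:\alpha\in\mathcal{E}_q(n)\}$ is a basis of $\mathbb{C}[B_q(n)]$. *)

theory Defs
  imports
    Complex_Main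
    "HOL-Library.Function_Algebras"
    "HOL-Library.FuncSet"
    "HOL-Library.Cardinality"
    "HOL-Algebra.Group"
    "Jordan_Normal_Form.Matrix"
begin

section \<open>Spaces of functions\<close>

text \<open>
  The finite field with \<open>q\<close> elements is a type \<open>'a :: {finite, field}\<close> with \<open>q = CARD('a)\<close>.
  Both column vectors and formal linear combinations are functions with pointwise operations.
\<close>

definition fscale :: "'k::field \<Rightarrow> ('i \<Rightarrow> 'k) \<Rightarrow> 'i \<Rightarrow> 'k" (infixr "*\<^sub>f" 75)
  where "c *\<^sub>f f = (\<lambda>i. c * f i)"

interpretation fs: vector_space "fscale :: 'k::field \<Rightarrow> ('i \<Rightarrow> 'k) \<Rightarrow> 'i \<Rightarrow> 'k"
  by unfold_locales (auto simp: fscale_def fun_eq_iff algebra_simps)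

section \<open>Column vectors and subspaces\<close>

text \<open>
  A column vector of length \<open>m\<close> is a function vanishing from index \<open>m\<close> on. Coordinates are
  counted from 0, so the paper's \<open>e\<^sub>j\<close> is \<open>unitv (j - 1)\<close>. With this encoding the
  identification of \<open>F\<^sub>q\<^sup>k\<close> (for \<open>k < m\<close>) with the vectors of \<open>F\<^sub>q\<^sup>m\<close> whose last
  \<open>m - k\<close> coordinates vanish is a literal inclusion.
\<close>

type_synonym 'a cvec = "nat \<Rightarrow> 'a"

definition Fq :: "nat \<Rightarrow> 'a::field cvec set"
  where "Fq m = {x. \<forall>i\<ge>m. x i = 0}"

definition unitv :: "nat \<Rightarrow> 'a::field cvec"
  where "unitv j = (\<lambda>i. if i = j then 1 else 0)"

definition subspaces_of :: "'a::field cvec set \<Rightarrow> 'a cvec set set"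
  where "subspaces_of X = {Y. fs.subspace Y \<and> Y \<subseteq> X}"

definition Bq :: "nat \<Rightarrow> 'a::field cvec set set"
  where "Bq m = subspaces_of (Fq m)"

text \<open>Application of a matrix to a column vector.\<close>

definition mat_app :: "'a::field mat \<Rightarrow> 'a cvec \<Rightarrow> 'a cvec"
  where "mat_app A x =
    (\<lambda>i. if i < dim_row A then (A *\<^sub>v vec (dim_col A) x) $ i else 0)"

definition col_vec :: "'a::field mat \<Rightarrow> nat \<Rightarrow> 'a cvec"
  where "col_vec A j = (\<lambda>i. if i < dim_row A then A $$ (i, j) else 0)"

definition col_span :: "'a::field mat \<Rightarrow> 'a cvec set"
  where "col_span A = fs.span (col_vec A ` {..<dim_col A})"

section \<open>Formal linear combinations\<close>

text \<open>
  An element of \<open>C[S]\<close>, for a finite set \<open>S\<close> of subspaces, is its coordinate function, extended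
  by 0 outside \<open>S\<close>; thus \<open>C[S] \<subseteq> C[T]\<close> holds literally whenever \<open>S \<subseteq> T\<close>.
\<close>

type_synonym 'a comb = "'a cvec set \<Rightarrow> complex"

definition bvec :: "'a cvec set \<Rightarrow> 'a comb"
  where "bvec Y = (\<lambda>X. if X = Y then 1 else 0)"

text \<open>The linear map on \<open>C[S]\<close> (\<open>S\<close> finite) with prescribed values \<open>f\<close> on the basis \<open>S\<close>.\<close>

definition lin_ext :: "'a cvec set set \<Rightarrow> ('a cvec set \<Rightarrow> 'a comb) \<Rightarrow> 'a comb \<Rightarrow> 'a comb"
  where "lin_ext S f v = (\<Sum>Z\<in>S. v Z *\<^sub>f f Z)"

section \<open>The maps of the construction\<close>

text \<open>\<open>Aq n\<close> is the paper's \<open>A\<^sub>q(n+1)\<close>.\<close>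

definition Aq :: "nat \<Rightarrow> 'a::field cvec set set"
  where "Aq n = {Y \<in> Bq (Suc n). \<not> Y \<subseteq> Fq n}"

definition theta :: "nat \<Rightarrow> 'a::{finite,field} comb \<Rightarrow> 'a comb"
  where "theta n = lin_ext (Bq n) (\<lambda>Z. \<Sum>Y | Y \<in> Aq n \<and> Y \<inter> Fq n = Z. bvec Y)"

definition hat :: "nat \<Rightarrow> 'a::field cvec set \<Rightarrow> 'a cvec set"
  where "hat n Z = fs.span (insert (unitv n) Z)"

text \<open>\<open>Hgrp n\<close> is the paper's \<open>H(n+1, F\<^sub>q)\<close>.\<close>

definition Hgrp :: "nat \<Rightarrow> 'a::field mat monoid"
  where "Hgrp n =
    \<lparr>carrier = {four_block_mat (1\<^sub>m n) a (0\<^sub>m 1 n) (1\<^sub>m 1) | a. a \<in> carrier_mat n 1},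
     mult = (*), one = 1\<^sub>m (Suc n)\<rparr>"

definition Cstar :: "complex monoid"
  where "Cstar = \<lparr>carrier = UNIV - {0}, mult = (*), one = 1\<rparr>"

text \<open>
  Homomorphisms are required to be extensional, so that distinct elements of \<open>Nq n\<close> differ on
  \<open>carrier (Hgrp n)\<close>.
\<close>

definition Nq :: "nat \<Rightarrow> ('a::field mat \<Rightarrow> complex) set"
  where "Nq n = {\<chi> \<in> hom (Hgrp n) Cstar \<inter> extensional (carrier (Hgrp n)).
    \<exists>g\<in>carrier (Hgrp n). \<chi> g \<noteq> 1}"

definition act :: "nat \<Rightarrow> 'a::{finite,field} mat \<Rightarrow> 'a comb \<Rightarrow> 'a comb"
  where "act n g = lin_ext (Aq n) (\<lambda>Y. bvec (mat_app g ` Y))"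

definition pchi :: "nat \<Rightarrow> ('a::{finite,field} mat \<Rightarrow> complex) \<Rightarrow> 'a comb \<Rightarrow> 'a comb"
  where "pchi n \<chi> v = (\<Sum>g\<in>carrier (Hgrp n). cnj (\<chi> g) *\<^sub>f act n g v)"

definition Xchi :: "nat \<Rightarrow> ('a::{finite,field} mat \<Rightarrow> complex) \<Rightarrow> 'a cvec set"
  where "Xchi n \<chi> =
    (THE X. X \<in> Bq n \<and> fs.dim X = n - 1 \<and> pchi n \<chi> (bvec (hat n X)) \<noteq> 0)"

definition lam :: "nat \<Rightarrow> ('a::{finite,field} mat \<Rightarrow> complex) \<Rightarrow> 'a comb \<Rightarrow> 'a comb"
  where "lam n \<chi> = lin_ext (subspaces_of (Xchi n \<chi>))
    (\<lambda>Y. (1 / of_nat CARD('a) ^ fs.dim Y) *\<^sub>f pchi n \<chi> (bvec (hat n Y)))"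

text \<open>\<open>r j\<close> is the row of the last nonzero entry of column \<open>j\<close>.\<close>

definition schubert_normal_form :: "'a::field mat \<Rightarrow> bool"
  where "schubert_normal_form M \<longleftrightarrow> (\<exists>r.
    (\<forall>j<dim_col M. r j < dim_row M \<and> M $$ (r j, j) = 1 \<and>
       (\<forall>i. r j < i \<and> i < dim_row M \<longrightarrow> M $$ (i, j) = 0)) \<and>
    (\<forall>j k. j < k \<and> k < dim_col M \<longrightarrow> r j < r k) \<and>
    (\<forall>j<dim_col M. \<forall>k<dim_col M. M $$ (r j, k) = (if j = k then 1 else 0)))"

definition Mmat :: "nat \<Rightarrow> 'a::field cvec set \<Rightarrow> 'a mat"
  where "Mmat n X =
    (THE M. M \<in> carrier_mat n (n - 1) \<and> schubert_normal_form M \<and> col_span M = X)"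

definition tau :: "nat \<Rightarrow> 'a::field cvec set \<Rightarrow> 'a cvec \<Rightarrow> 'a cvec"
  where "tau n X x = (\<Sum>j<n - 1. x j *\<^sub>f col_vec (Mmat n X) j)"

definition mu :: "nat \<Rightarrow> 'a::{finite,field} cvec set \<Rightarrow> 'a comb \<Rightarrow> 'a comb"
  where "mu n X = lin_ext (Bq (n - 1)) (\<lambda>Y. bvec (tau n X ` Y))"

section \<open>Index sequences and the basis vectors\<close>

datatype 'a entry = Zero | One | Chi "'a mat \<Rightarrow> complex"

fun Eq :: "nat \<Rightarrow> 'a::{finite,field} entry list set" where
  "Eq 0 = {[]}"
| "Eq (Suc 0) = {[Zero], [One]}"
| "Eq (Suc (Suc n)) =
     {\<beta> @ [a] | \<beta> a. \<beta> \<in> Eq (Suc n) \<and> a \<in> {Zero, One}} \<union>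
     {\<beta> @ [Chi \<chi>] | \<beta> \<chi>. \<beta> \<in> Eq n \<and> \<chi> \<in> Nq (Suc n)}"

definition Nnz :: "'a entry list \<Rightarrow> nat"
  where "Nnz \<alpha> = length (filter (\<lambda>a. a \<noteq> Zero) \<alpha>)"

text \<open>
  \<open>basis_vec n \<alpha>\<close> is the paper's \<open>v\<^sub>\<alpha>\<close>, meaningful for \<open>\<alpha> \<in> Eq n\<close>. For such
  \<open>\<alpha>\<close> the truncated subtraction below is exact: \<open>Nnz (butlast \<alpha>) \<le> n - 1\<close>.
\<close>

fun basis_vec :: "nat \<Rightarrow> 'a::{finite,field} entry list \<Rightarrow> 'a comb" where
  "basis_vec 0 \<alpha> = bvec {0}"
| "basis_vec (Suc 0) \<alpha> =
     (if \<alpha> = [Zero] then bvec {0} + bvec (Fq 1) else bvec {0} - bvec (Fq 1))"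
| "basis_vec (Suc (Suc n)) \<alpha> =
     (let \<beta> = butlast \<alpha>; k = Nnz \<beta>; q = of_nat CARD('a) in
      case last \<alpha> of
        Zero \<Rightarrow> q ^ k *\<^sub>f basis_vec (Suc n) \<beta> + theta (Suc n) (basis_vec (Suc n) \<beta>)
      | One \<Rightarrow> q ^ (Suc n - k) *\<^sub>f basis_vec (Suc n) \<beta> - theta (Suc n) (basis_vec (Suc n) \<beta>)
      | Chi \<chi> \<Rightarrow> lam (Suc n) \<chi> (mu (Suc n) (Xchi (Suc n) \<chi>) (basis_vec n \<beta>)))"

section \<open>The inner product\<close>

definition Pq :: "nat \<Rightarrow> nat \<Rightarrow> complex"
  where "Pq q n = (\<Prod>i<n. 1 + of_nat q ^ i)"

definition inner_q :: "nat \<Rightarrow> 'a::{finite,field} comb \<Rightarrow> 'a comb \<Rightarrow> complex"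
  where "inner_q n u v =
    (\<Sum>X\<in>Bq n. cnj (u X) * v X * (of_nat CARD('a) ^ (fs.dim X choose 2) / Pq CARD('a) n))"

end

theory Submission
  imports Defs
begin

text \<open>
  Each \<open>W \<in> Aq n\<close> is the span of \<open>Z = W \<inter> Fq n\<close> and a vector \<open>unitv n + a\<close> with \<open>a \<in> Fq n\<close> unique
  modulo \<open>Z\<close>. In the coordinates \<open>(Z, a)\<close> the vector \<open>theta v\<close> is \<open>v Z\<close>, and \<open>lam \<chi> v\<close> is
  \<open>v Z\<close> times the conjugate of \<open>\<chi>\<close> at \<open>a\<close>, since \<open>\<chi>\<close> is trivial on \<open>Xchi \<chi>\<close>. The weighted
  inner product over \<open>Aq n\<close> becomes a sum over \<open>a\<close> followed by the weighted sum over \<open>Z\<close>.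
  Orthogonality of characters separates vectors with different characters (entries 0 and 1 count
  as the trivial one). For one nontrivial character the inner product reduces through \<open>tau\<close> to
  level \<open>n - 1\<close>. For entries 0 and 1 it reduces to the prefixes at level \<open>n\<close>, and for a common
  prefix it has the factor \<open>q\<^sup>k q\<^sup>n\<^sup>-\<^sup>k - q\<^sup>n = 0\<close>.
\<close>

section \<open>Finite subspaces and lifts\<close>

lemma mem_span_insert_subspace:
  assumes "fs.subspace Z"
  shows "x \<in> fs.span (insert v Z) \<longleftrightarrow> (\<exists>z\<in>Z. \<exists>t. x = z + t *\<^sub>f v)"
proof -
  have "fs.span Z = Z" using assms by simp
  then have "x \<in> fs.span (insert v Z) \<longleftrightarrow> (\<exists>k. x - k *\<^sub>f v \<in> Z)"
    by (simp only: fs.span_insert mem_Collect_eq)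
  also have "\<dots> \<longleftrightarrow> (\<exists>z\<in>Z. \<exists>t. x = z + t *\<^sub>f v)"
    by (metis add_diff_cancel diff_add_cancel)
  finally show ?thesis .
qed

text \<open>A vector of the span is \<open>z + t v\<close> for exactly one pair
  \<open>(z, t)\<close>: two different values of \<open>t\<close> would make \<open>v\<close> a
  multiple of an element of \<open>Z\<close>.\<close>

lemma card_span_insert:
  fixes Z :: "('i \<Rightarrow> 'a::{finite,field}) set"
  assumes Z: "fs.subspace Z" and v: "v \<notin> Z"
  shows "card (fs.span (insert v Z)) = CARD('a) * card Z"
proof -
  let ?f = "\<lambda>(z, t). z + t *\<^sub>f v"
  have "inj_on ?f (Z \<times> UNIV)"
  proof (rule inj_onI, clarify)
    fix z t z' t'
    assume zz: "z \<in> Z" "z' \<in> Z" and e: "z + t *\<^sub>f v = z' + t' *\<^sub>f v"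
    from e have d: "(t - t') *\<^sub>f v = z' - z"
      by (simp add: fs.scale_left_diff_distrib algebra_simps)
    have "t = t'"
    proof (rule ccontr)
      assume "t \<noteq> t'"
      then have "v = inverse (t - t') *\<^sub>f (z' - z)"
        by (simp flip: d)
      then show False
        using v Z zz by (metis fs.subspace_diff fs.subspace_scale)
    qed
    with e show "z = z' \<and> t = t'" by simp
  qed
  moreover have "?f ` (Z \<times> UNIV) = fs.span (insert v Z)"
    by (force simp: mem_span_insert_subspace[OF Z])
  ultimately have "card (fs.span (insert v Z)) = card (Z \<times> (UNIV :: 'a set))"
    by (metis card_image)
  then show ?thesis by (simp add: card_cartesian_product mult.commute)
qed

text \<open>Each new vector of a basis multiplies the size of the span by \<open>q\<close>.
  Dimensions are later read off from cardinalities in this way, as in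
  \<open>dim_eqI\<close>.\<close>

lemma card_subspace:
  fixes Y :: "('i \<Rightarrow> 'a::{finite,field}) set"
  assumes "fs.subspace Y" and "finite Y"
  shows "card Y = CARD('a) ^ fs.dim Y"
proof -
  have *: "finite B \<Longrightarrow> fs.independent B \<Longrightarrow> card (fs.span B) = CARD('a) ^ card B"
    for B :: "('i \<Rightarrow> 'a) set"
  proof (induction B rule: finite_induct)
    case empty
    then show ?case by simp
  next
    case (insert b B)
    then have "fs.independent B" and b: "b \<notin> fs.span B"
      by (auto simp: fs.independent_insert)
    moreover have "fs.span (insert b B) = fs.span (insert b (fs.span B))"
      by (simp only: fs.span_insert fs.span_span)
    ultimately show ?case
      using insert by (simp add: card_span_insert)
  qed
  obtain B where B: "B \<subseteq> Y" "fs.independent B" "Y \<subseteq> fs.span B" "card B = fs.dim Y"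
    using fs.basis_exists by blast
  then have "fs.span B = Y"
    using assms by (metis fs.span_subspace)
  then show ?thesis
    using * B assms(2) by (metis finite_subset)
qed

lemma CARD_field_gt_1: "CARD('a::{finite,field}) > 1"
proof -
  have "card {0, 1::'a} \<le> CARD('a)" by (rule card_mono) auto
  then show ?thesis by simp
qed

section \<open>Coordinate spaces and the lifts of their subspaces\<close>

lemma subspace_Fq: "fs.subspace (Fq n)"
  by (auto simp: fs.subspace_def Fq_def fscale_def)

lemma Fq_mono: "m \<le> n \<Longrightarrow> Fq m \<subseteq> Fq n"
  by (auto simp: Fq_def)

lemma unitv_in_Fq [simp]: "unitv j \<in> (Fq n :: 'a::field cvec set) \<longleftrightarrow> j < n"
  by (auto simp: Fq_def unitv_def)

lemma Fq_0: "Fq 0 = {0}"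
  by (auto simp: Fq_def fun_eq_iff)

lemma in_Fq_iff_last:
  assumes "x \<in> Fq (Suc n)"
  shows "x \<in> Fq n \<longleftrightarrow> x n = 0"
  using assms by (auto simp: Fq_def) (metis le_antisym not_less_eq_eq)

text \<open>This is \<open>hat n Z\<close> moved by the group element with last column
  \<open>a\<close>, see \<open>mat_app_shear_hat\<close>. Every member of \<open>Aq n\<close> has
  this form by \<open>Aq_ex_lift\<close>.\<close>

definition lift :: "nat \<Rightarrow> 'a::field cvec \<Rightarrow> 'a cvec set \<Rightarrow> 'a cvec set"
  where "lift n a Z = fs.span (insert (unitv n + a) Z)"

lemma hat_eq_lift: "hat n Z = lift n 0 Z"
  by (simp add: hat_def lift_def)

lemma Bq_subspace: "Y \<in> Bq n \<Longrightarrow> fs.subspace Y"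
  and Bq_subset: "Y \<in> Bq n \<Longrightarrow> Y \<subseteq> Fq n"
  by (auto simp: Bq_def subspaces_of_def)

lemma BqI: "fs.subspace Y \<Longrightarrow> Y \<subseteq> Fq n \<Longrightarrow> Y \<in> Bq n"
  by (auto simp: Bq_def subspaces_of_def)

lemma Fq_add: "a \<in> Fq n \<Longrightarrow> b \<in> Fq n \<Longrightarrow> a + b \<in> Fq n"
  and Fq_diff: "a \<in> Fq n \<Longrightarrow> b \<in> Fq n \<Longrightarrow> a - b \<in> Fq n"
  and Fq_scale: "a \<in> Fq n \<Longrightarrow> c *\<^sub>f a \<in> Fq n"
  and Fq_zero [simp]: "0 \<in> Fq n"
  by (auto intro: subspace_Fq fs.subspace_add fs.subspace_diff fs.subspace_scale fs.subspace_0)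

lemma mem_lift:
  assumes "Z \<in> Bq n"
  shows "x \<in> lift n a Z \<longleftrightarrow> (\<exists>z\<in>Z. \<exists>t. x = z + t *\<^sub>f (unitv n + a))"
  unfolding lift_def using mem_span_insert_subspace[OF Bq_subspace[OF assms]] .

lemma unitv_add_notin_Fq: "a \<in> Fq n \<Longrightarrow> unitv n + a \<notin> Fq n"
  by (auto simp: Fq_def unitv_def)

lemma add_scale_in_Fq_iff:
  assumes "z \<in> Fq n" "a \<in> Fq n"
  shows "z + t *\<^sub>f (unitv n + a) \<in> Fq n \<longleftrightarrow> t = 0"
  using assms by (auto simp: Fq_def unitv_def fscale_def)

lemma lift_Int_Fq:
  assumes "Z \<in> Bq n" "a \<in> Fq n"
  shows "lift n a Z \<inter> Fq n = Z"
proof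
  show "lift n a Z \<inter> Fq n \<subseteq> Z"
    using assms subsetD[OF Bq_subset[OF assms(1)]] by (auto simp: mem_lift add_scale_in_Fq_iff)
  show "Z \<subseteq> lift n a Z \<inter> Fq n"
    using Bq_subset[OF assms(1)] fs.span_superset[of "insert (unitv n + a) Z"]
    by (auto simp: lift_def)
qed

lemma lift_mem: "unitv n + a \<in> lift n a Z"
  by (simp add: lift_def fs.span_base)

lemma lift_in_Aq:
  assumes "Z \<in> Bq n" "a \<in> Fq n"
  shows "lift n a Z \<in> Aq n"
proof -
  have u: "unitv n + a \<in> Fq (Suc n)"
    using assms Fq_mono[of n "Suc n"] by (intro Fq_add) auto
  moreover have "Z \<subseteq> Fq (Suc n)"
    using Bq_subset[OF assms(1)] Fq_mono[of n "Suc n"] by (meson le_SucI le_refl order_trans)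
  ultimately have "lift n a Z \<subseteq> Fq (Suc n)"
    unfolding lift_def by (intro fs.span_minimal subspace_Fq) auto
  moreover have "fs.subspace (lift n a Z)"
    by (simp add: lift_def)
  moreover have "\<not> lift n a Z \<subseteq> Fq n"
    using lift_mem[of n a Z] unitv_add_notin_Fq[OF assms(2)] by blast
  ultimately show ?thesis
    by (simp add: Aq_def BqI)
qed

lemma Aq_Int_Fq: "Y \<in> Aq n \<Longrightarrow> Y \<inter> Fq n \<in> Bq n"
  by (simp add: Aq_def Bq_def subspaces_of_def fs.subspace_inter subspace_Fq)

lemma Aq_ex_lift:
  assumes "Y \<in> Aq n"
  shows "\<exists>a\<in>Fq n. Y = lift n a (Y \<inter> Fq n)"
proof -
  from assms have Y: "fs.subspace Y" "Y \<subseteq> Fq (Suc n)"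
    by (auto simp: Aq_def Bq_def subspaces_of_def)
  obtain y where y: "y \<in> Y" "y \<notin> Fq n"
    using assms by (auto simp: Aq_def)
  then have yn: "y n \<noteq> 0" and yF: "y \<in> Fq (Suc n)"
    using Y in_Fq_iff_last by blast+
  \<comment> \<open>Scaling \<open>y\<close> makes its coordinate \<open>n\<close> equal to 1;
    \<open>a\<close> is the rest after removal of \<open>unitv n\<close>.\<close>
  define a where "a = inverse (y n) *\<^sub>f y - unitv n"
  have "a \<in> Fq (Suc n)"
    unfolding a_def using yF by (intro Fq_diff Fq_scale) auto
  moreover have "a n = 0"
    using yn by (simp add: a_def fscale_def unitv_def)
  ultimately have a: "a \<in> Fq n"
    using in_Fq_iff_last by blast
  have u: "unitv n + a \<in> Y"
    using Y y by (simp add: a_def fs.subspace_scale)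
  have "Y = lift n a (Y \<inter> Fq n)"
  proof
    show "lift n a (Y \<inter> Fq n) \<subseteq> Y"
      unfolding lift_def using u Y by (intro fs.span_minimal) auto
    show "Y \<subseteq> lift n a (Y \<inter> Fq n)"
    proof
      fix x assume x: "x \<in> Y"
      \<comment> \<open>Subtracting this multiple clears the coordinate \<open>n\<close> without
        leaving \<open>Y\<close>.\<close>
      let ?z = "x - x n *\<^sub>f (unitv n + a)"
      have "?z \<in> Y" using x u Y by (simp add: fs.subspace_diff fs.subspace_scale)
      moreover have "?z n = 0" using \<open>a n = 0\<close> by (simp add: fscale_def unitv_def)
      ultimately have "?z \<in> Y \<inter> Fq n" using Y in_Fq_iff_last[of ?z n] by auto
      then show "x \<in> lift n a (Y \<inter> Fq n)"
        by (subst mem_lift[OF Aq_Int_Fq[OF assms]]) (metis diff_add_cancel)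
    qed
  qed
  with a show ?thesis by blast
qed

text \<open>\<open>Fq (Suc n)\<close> is itself a lift of \<open>Fq n\<close>, so each induction
  step multiplies the cardinality by \<open>q\<close>.\<close>

lemma finite_card_Fq:
  "finite (Fq n :: 'a::{finite,field} cvec set) \<and> card (Fq n :: 'a cvec set) = CARD('a) ^ n"
proof (induction n)
  case 0
  then show ?case by (simp add: Fq_0)
next
  case (Suc n)
  have "Fq (Suc n) \<in> (Aq n :: 'a cvec set set)"
    by (auto simp: Aq_def Bq_def subspaces_of_def subspace_Fq)
       (metis lessI less_irrefl subsetD unitv_in_Fq)
  then obtain a where a: "a \<in> Fq n"
    and *: "(Fq (Suc n) :: 'a cvec set) = lift n a (Fq (Suc n) \<inter> Fq n)"
    using Aq_ex_lift by blast
  have "(Fq (Suc n) :: 'a cvec set) \<inter> Fq n = Fq n"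
    using Fq_mono[of n "Suc n"] by auto
  then have e: "Fq (Suc n) = fs.span (insert (unitv n + a) (Fq n))"
    using * by (simp add: lift_def)
  have "card (Fq (Suc n) :: 'a cvec set) = CARD('a) ^ Suc n"
    using Suc by (simp add: e card_span_insert[OF subspace_Fq unitv_add_notin_Fq[OF a]])
  \<comment> \<open>An infinite set has \<open>card\<close> 0, so the positive cardinality yields
    finiteness.\<close>
  moreover from this have "finite (Fq (Suc n) :: 'a cvec set)"
    by (intro card_ge_0_finite) simp
  ultimately show ?case by simp
qed

lemmas finite_Fq = finite_card_Fq[THEN conjunct1]
  and card_Fq = finite_card_Fq[THEN conjunct2]

lemma finite_Bq: "finite (Bq n :: 'a::{finite,field} cvec set set)"
  using finite_Fq[where 'a='a, of n] finite_subset[of "Bq n" "Pow (Fq n)"] Bq_subset by blast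

lemma finite_Aq: "finite (Aq n :: 'a::{finite,field} cvec set set)"
  using finite_Bq[where 'a='a, of "Suc n"] by (simp add: Aq_def)

lemma finite_mem_Bq: "Y \<in> Bq n \<Longrightarrow> finite (Y :: 'a::{finite,field} cvec set)"
  using Bq_subset finite_Fq finite_subset by blast

lemma card_mem_Bq: "Y \<in> Bq n \<Longrightarrow> card Y = CARD('a) ^ fs.dim Y"
  for Y :: "'a::{finite,field} cvec set"
  using Bq_subspace card_subspace finite_mem_Bq by blast

lemma dim_eqI:
  fixes Y :: "'a::{finite,field} cvec set"
  assumes "Y \<in> Bq n" and "card Y = CARD('a) ^ d"
  shows "fs.dim Y = d"
proof -
  have "CARD('a) ^ fs.dim Y = CARD('a) ^ d"
    using assms card_mem_Bq by metis
  then show ?thesis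
    using CARD_field_gt_1[where 'a='a] power_inject_exp by blast
qed

lemma dim_lift:
  fixes Z :: "'a::{finite,field} cvec set"
  assumes "Z \<in> Bq n" "a \<in> Fq n"
  shows "fs.dim (lift n a Z) = Suc (fs.dim Z)"
proof -
  have "card (lift n a Z) = CARD('a) ^ Suc (fs.dim Z)"
    using assms card_span_insert[OF Bq_subspace[OF assms(1)]] Bq_subset[OF assms(1)]
      unitv_add_notin_Fq[OF assms(2)]
    by (auto simp: lift_def card_mem_Bq[OF assms(1)])
  moreover have "lift n a Z \<in> Bq (Suc n)"
    using lift_in_Aq[OF assms] by (simp add: Aq_def)
  ultimately show ?thesis by (rule dim_eqI[rotated])
qed

text \<open>The difference of the two generators is \<open>a - b\<close>, which lies in
  \<open>Fq n\<close>; the part of a lift inside \<open>Fq n\<close> is only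
  \<open>Z\<close>.\<close>

lemma lift_eq_iff:
  assumes "Z \<in> Bq n" "a \<in> Fq n" "b \<in> Fq n"
  shows "lift n a Z = lift n b Z \<longleftrightarrow> a - b \<in> Z"
proof
  have Z: "fs.subspace Z" using assms(1) by (rule Bq_subspace)
  assume "lift n a Z = lift n b Z"
  then have "(unitv n + a) - (unitv n + b) \<in> lift n b Z"
    using lift_mem[of n a Z] lift_mem[of n b Z] unfolding lift_def by (metis fs.span_diff)
  then show "a - b \<in> Z"
    using assms lift_Int_Fq[of Z n b] Fq_diff[of a n b] by auto
next
  have *: "lift n a Z \<subseteq> lift n b Z" if "a - b \<in> Z" for a b
  proof -
    have "unitv n + a = (unitv n + b) + (a - b)" by simp
    then have "unitv n + a \<in> lift n b Z"
      unfolding lift_def using that by (metis fs.span_add fs.span_base insertI1 insertI2)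
    then show ?thesis
      unfolding lift_def by (intro fs.span_minimal) (auto simp: fs.span_base)
  qed
  assume "a - b \<in> Z"
  moreover from this have "b - a \<in> Z"
    using Bq_subspace[OF assms(1)] by (metis fs.subspace_neg minus_diff_eq)
  ultimately show "lift n a Z = lift n b Z" using * by blast
qed

text \<open>The members of \<open>Aq n\<close> over a given \<open>Z\<close> correspond to the
  cosets of \<open>Z\<close> in \<open>Fq n\<close>, so the sum over \<open>a\<close> counts each of
  them \<open>card Z\<close> times.\<close>

lemma sum_Aq:
  fixes f :: "'a::{finite,field} cvec set \<Rightarrow> complex"
  shows "(\<Sum>W\<in>Aq n. f W) = (\<Sum>Z\<in>Bq n. (\<Sum>a\<in>Fq n. f (lift n a Z)) / of_nat (card Z))"
proof -
  have fib: "(\<Sum>a\<in>Fq n. f (lift n a Z)) = of_nat (card Z) * (\<Sum>W | W \<in> Aq n \<and> W \<inter> Fq n = Z. f W)"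
    if Z: "Z \<in> Bq n" for Z
  proof -
    let ?T = "{W \<in> Aq n. W \<inter> Fq n = Z}"
    have "(\<Sum>a\<in>Fq n. f (lift n a Z)) = (\<Sum>W\<in>?T. \<Sum>a | a \<in> Fq n \<and> lift n a Z = W. f (lift n a Z))"
      using Z by (intro sum.group[symmetric])
        (simp_all add: finite_Fq finite_Aq image_subset_iff lift_in_Aq lift_Int_Fq)
    also have "\<dots> = (\<Sum>W\<in>?T. of_nat (card Z) * f W)"
    proof (rule sum.cong[OF refl])
      fix W assume "W \<in> ?T"
      then obtain b where b: "b \<in> Fq n" "W = lift n b Z"
        using Aq_ex_lift by blast
      have "{a \<in> Fq n. lift n a Z = W} = {a \<in> Fq n. a - b \<in> Z}"
        using b by (intro Collect_cong) (simp add: lift_eq_iff[OF Z _ b(1)] cong: conj_cong)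
      also have "\<dots> = (\<lambda>z. z + b) ` Z"
        using b(1) Bq_subset[OF Z]
        by (auto simp: image_iff intro!: Fq_add) (metis diff_add_cancel)
      finally have "{a \<in> Fq n. lift n a Z = W} = (\<lambda>z. z + b) ` Z" .
      then have "card {a \<in> Fq n. lift n a Z = W} = card Z"
        by (simp add: card_image)
      then show "(\<Sum>a | a \<in> Fq n \<and> lift n a Z = W. f (lift n a Z)) = of_nat (card Z) * f W"
        by simp
    qed
    finally show ?thesis by (simp add: sum_distrib_left)
  qed
  have "(\<Sum>W\<in>Aq n. f W) = (\<Sum>Z\<in>Bq n. \<Sum>W | W \<in> Aq n \<and> W \<inter> Fq n = Z. f W)"
    by (intro sum.group[symmetric]) (auto simp: finite_Aq finite_Bq Aq_Int_Fq)
  also have "\<dots> = (\<Sum>Z\<in>Bq n. (\<Sum>a\<in>Fq n. f (lift n a Z)) / of_nat (card Z))"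
    by (intro sum.cong) (auto simp: fib card_mem_Bq)
  finally show ?thesis .
qed

section \<open>Characters\<close>

definition add_subgroup :: "'b::ab_group_add set \<Rightarrow> bool"
  where "add_subgroup V \<longleftrightarrow> 0 \<in> V \<and> (\<forall>a\<in>V. \<forall>b\<in>V. a - b \<in> V)"

text \<open>One notion serves the additive group of the field, the spaces \<open>Fq n\<close> and
  their subspaces. Values of modulus 1 are a consequence when the group is finite, see
  \<open>cmod_char_on\<close>.\<close>

definition char_on :: "'b::ab_group_add set \<Rightarrow> ('b \<Rightarrow> complex) \<Rightarrow> bool"
  where "char_on V \<psi> \<longleftrightarrow> (\<forall>a\<in>V. \<psi> a \<noteq> 0) \<and> (\<forall>a\<in>V. \<forall>b\<in>V. \<psi> (a + b) = \<psi> a * \<psi> b)"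

lemma bij_betw_translation:
  assumes "add_subgroup V" and "c \<in> V"
  shows "bij_betw ((+) c) V V"
proof (rule bij_betw_byWitness[where f' = "\<lambda>x. x - c"])
  \<comment> \<open>Closure under sums is obtained from closure under differences.\<close>
  have "c - (0 - a) \<in> V" if "a \<in> V" for a
    using assms that unfolding add_subgroup_def by blast
  then show "(+) c ` V \<subseteq> V" by auto
  show "(\<lambda>x. x - c) ` V \<subseteq> V"
    using assms by (auto simp: add_subgroup_def)
qed auto

lemma char_on_0:
  assumes "char_on V \<psi>" and "add_subgroup V"
  shows "\<psi> 0 = 1"
proof -
  have "0 \<in> V" using assms by (simp add: add_subgroup_def)
  then have "\<psi> 0 \<noteq> 0" and "\<psi> (0 + 0) = \<psi> 0 * \<psi> 0"
    using assms(1) unfolding char_on_def by blast+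
  then show ?thesis by simp
qed

text \<open>Translation by \<open>c\<close> permutes \<open>V\<close> and multiplies the product of
  all values by \<open>\<psi> c ^ card V\<close>, so \<open>\<psi> c\<close> is a root of
  unity.\<close>

lemma cmod_char_on:
  assumes V: "add_subgroup V" "finite V" and \<psi>: "char_on V \<psi>" and c: "c \<in> V"
  shows "cmod (\<psi> c) = 1"
proof -
  have "(\<Prod>a\<in>V. \<psi> a) = (\<Prod>a\<in>V. \<psi> (c + a))"
    by (intro prod.reindex_bij_betw[symmetric] bij_betw_translation V c)
  also have "\<dots> = \<psi> c ^ card V * (\<Prod>a\<in>V. \<psi> a)"
    using \<psi> c by (simp add: char_on_def prod.distrib)
  finally have "\<psi> c ^ card V = 1"
    using \<psi> V(2) by (auto simp: char_on_def)
  then have "cmod (\<psi> c) ^ card V = 1"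
    by (metis norm_one norm_power)
  moreover have "card V > 0"
    using c V(2) card_gt_0_iff by blast
  ultimately show ?thesis
    using power_eq_iff_eq_base[of "card V" "cmod (\<psi> c)" 1] by simp
qed

lemma cnj_mult_char_on:
  assumes "add_subgroup V" "finite V" "char_on V \<psi>" "c \<in> V"
  shows "cnj (\<psi> c) * \<psi> c = 1"
  using cmod_char_on[OF assms] by (metis complex_norm_square mult.commute of_real_1 power_one)

text \<open>Translation by \<open>c\<close> leaves the sum unchanged but also multiplies it by
  \<open>\<psi> c\<close>.\<close>

lemma sum_char_on:
  assumes V: "add_subgroup V" and \<psi>: "char_on V \<psi>" and c: "c \<in> V" "\<psi> c \<noteq> 1"
  shows "(\<Sum>a\<in>V. \<psi> a) = 0"
proof -
  have "(\<Sum>a\<in>V. \<psi> a) = (\<Sum>a\<in>V. \<psi> (c + a))"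
    by (intro sum.reindex_bij_betw[symmetric] bij_betw_translation V c)
  also have "\<dots> = \<psi> c * (\<Sum>a\<in>V. \<psi> a)"
    using \<psi> c by (simp add: char_on_def sum_distrib_left)
  finally show ?thesis using c by simp
qed

lemma char_on_cnj: "char_on V \<psi> \<Longrightarrow> char_on V (\<lambda>a. cnj (\<psi> a))"
  by (simp add: char_on_def)

lemma char_on_mult: "char_on V \<psi> \<Longrightarrow> char_on V \<phi> \<Longrightarrow> char_on V (\<lambda>a. \<psi> a * \<phi> a)"
  by (simp add: char_on_def)

lemma char_on_subset: "char_on V \<psi> \<Longrightarrow> U \<subseteq> V \<Longrightarrow> char_on U \<psi>"
  by (auto simp: char_on_def)

text \<open>On a finite group conjugation inverts a character, so the summand is the quotient of the
  two, a character with value different from 1 at \<open>c\<close>.\<close>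

lemma char_on_orthogonal:
  assumes V: "add_subgroup V" "finite V" and "char_on V \<psi>" "char_on V \<phi>"
    and c: "c \<in> V" "\<psi> c \<noteq> \<phi> c"
  shows "(\<Sum>a\<in>V. cnj (\<psi> a) * \<phi> a) = 0"
proof (rule sum_char_on[OF V(1) _ c(1)])
  show "char_on V (\<lambda>a. cnj (\<psi> a) * \<phi> a)"
    using assms by (intro char_on_mult char_on_cnj)
  have "\<psi> c \<noteq> 0" using assms by (auto simp: char_on_def)
  then show "cnj (\<psi> c) * \<phi> c \<noteq> 1"
    using cnj_mult_char_on[OF V assms(3) c(1)] c(2)
    by (metis complex_cnj_zero_iff mult_cancel_left)
qed

text \<open>Self-duality of the additive group of the field. A character different from all
  \<open>t \<mapsto> \<psi> (c t)\<close> would be orthogonal to each of them, but summing these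
  inner products over \<open>c\<close> gives \<open>q\<close>.\<close>

lemma char_of_finite_field:
  fixes \<psi> \<phi> :: "'a::{finite,field} \<Rightarrow> complex"
  assumes \<psi>: "char_on UNIV \<psi>" and t0: "\<psi> t0 \<noteq> 1" and \<phi>: "char_on UNIV \<phi>"
  shows "\<exists>c. \<forall>t. \<phi> t = \<psi> (c * t)"
proof (rule ccontr)
  assume neg: "\<nexists>c. \<forall>t. \<phi> t = \<psi> (c * t)"
  have V: "add_subgroup (UNIV :: 'a set)" by (simp add: add_subgroup_def)
  have "(\<Sum>t\<in>UNIV. cnj (\<psi> (c * t)) * \<phi> t) = 0" for c
  proof -
    obtain t where "\<phi> t \<noteq> \<psi> (c * t)" using neg by blast
    moreover have "char_on UNIV (\<lambda>t. \<psi> (c * t))"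
      using \<psi> by (simp add: char_on_def distrib_left)
    ultimately show ?thesis
      using char_on_orthogonal[OF V _ _ \<phi>, of "\<lambda>t. \<psi> (c * t)" t] by simp
  qed
  then have "0 = (\<Sum>c\<in>(UNIV::'a set). \<Sum>t\<in>UNIV. cnj (\<psi> (c * t)) * \<phi> t)"
    by simp
  \<comment> \<open>After the exchange the inner sum is a character sum in \<open>c\<close>, which
    is nontrivial unless \<open>t = 0\<close>; the value at \<open>c = t0 / t\<close> shows
    this.\<close>
  also have "\<dots> = (\<Sum>t\<in>UNIV. (\<Sum>c\<in>(UNIV::'a set). cnj (\<psi> (c * t))) * \<phi> t)"
    by (subst sum.swap) (simp add: sum_distrib_right)
  also have "\<dots> = (\<Sum>t\<in>(UNIV::'a set). if t = 0 then of_nat CARD('a) else 0)"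
  proof (rule sum.cong[OF refl])
    fix t :: 'a
    show "(\<Sum>c\<in>UNIV. cnj (\<psi> (c * t))) * \<phi> t = (if t = 0 then of_nat CARD('a) else 0)"
    proof (cases "t = 0")
      case True
      then show ?thesis
        using char_on_0[OF \<psi> V] char_on_0[OF \<phi> V] by simp
    next
      case False
      have "(\<Sum>c\<in>UNIV. cnj (\<psi> (c * t))) = 0"
      proof (rule sum_char_on[OF V, of _ "t0 / t"])
        show "char_on UNIV (\<lambda>c. cnj (\<psi> (c * t)))"
          using \<psi> by (simp add: char_on_def distrib_right)
        show "cnj (\<psi> (t0 / t * t)) \<noteq> 1"
          using False t0 by (metis complex_cnj_cnj complex_cnj_one nonzero_eq_divide_eq)
      qed simp
      with False show ?thesis by simp
    qed
  qed
  also have "\<dots> = of_nat CARD('a)" by simp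
  finally show False by simp
qed

lemma add_subgroup_subspace: "fs.subspace V \<Longrightarrow> add_subgroup V"
  by (simp add: add_subgroup_def fs.subspace_0 fs.subspace_diff)

section \<open>The group \<open>Hgrp n\<close> as the additive group \<open>Fq n\<close>\<close>

definition shear :: "nat \<Rightarrow> 'a::field cvec \<Rightarrow> 'a mat"
  where "shear n a = four_block_mat (1\<^sub>m n) (mat n 1 (\<lambda>(i, _). a i)) (0\<^sub>m 1 n) (1\<^sub>m 1)"

lemma shear_index:
  "i < Suc n \<Longrightarrow> j < Suc n \<Longrightarrow>
    shear n a $$ (i, j) = (if i = j then 1 else if j = n then a i else 0)"
  by (auto simp: shear_def)

lemma bij_betw_shear: "bij_betw (shear n) (Fq n) (carrier (Hgrp n))"
proof (rule bij_betwI')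
  fix a b :: "'a cvec"
  assume ab: "a \<in> Fq n" "b \<in> Fq n"
  show "shear n a = shear n b \<longleftrightarrow> a = b"
  proof
    assume e: "shear n a = shear n b"
    show "a = b"
    proof
      fix i
      show "a i = b i"
      proof (cases "i < n")
        case True
        then show ?thesis
          using shear_index[of i n n a] shear_index[of i n n b] e by simp
      qed (use ab in \<open>simp add: Fq_def\<close>)
    qed
  qed simp
next
  fix a :: "'a cvec" assume "a \<in> Fq n"
  show "shear n a \<in> carrier (Hgrp n)"
    by (auto simp: Hgrp_def shear_def)
next
  fix g :: "'a mat" assume "g \<in> carrier (Hgrp n)"
  then obtain A where A: "A \<in> carrier_mat n 1"
    and g: "g = four_block_mat (1\<^sub>m n) A (0\<^sub>m 1 n) (1\<^sub>m 1)"
    by (auto simp: Hgrp_def)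
  define a where "a = (\<lambda>i. if i < n then A $$ (i, 0) else 0)"
  have "mat n 1 (\<lambda>(i, _). a i) = A"
    using A by (intro eq_matI) (auto simp: a_def)
  then have "g = shear n a" by (simp add: g shear_def)
  moreover have "a \<in> Fq n" by (simp add: a_def Fq_def)
  ultimately show "\<exists>a\<in>Fq n. g = shear n a" by blast
qed

lemma shear_add: "shear n (a + b) = shear n a * shear n b"
proof -
  let ?A = "\<lambda>a::'a cvec. mat n 1 (\<lambda>(i, _). a i)"
  have "shear n a * shear n b =
    four_block_mat (1\<^sub>m n * 1\<^sub>m n + ?A a * 0\<^sub>m 1 n) (1\<^sub>m n * ?A b + ?A a * 1\<^sub>m 1)
      (0\<^sub>m 1 n * 1\<^sub>m n + 1\<^sub>m 1 * 0\<^sub>m 1 n) (0\<^sub>m 1 n * ?A b + 1\<^sub>m 1 * 1\<^sub>m 1)"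
    unfolding shear_def by (rule mult_four_block_mat) auto
  also have "\<dots> = shear n (a + b)"
  proof -
    have "1\<^sub>m n * ?A b + ?A a * 1\<^sub>m 1 = ?A (a + b)"
      by (intro eq_matI) (auto simp: left_mult_one_mat[of _ n 1] right_mult_one_mat[of _ n 1] add.commute)
    then show ?thesis by (simp add: shear_def)
  qed
  finally show ?thesis ..
qed

lemma mat_app_shear:
  assumes x: "x \<in> Fq (Suc n)" and a: "a \<in> Fq n"
  shows "mat_app (shear n a) x = x + x n *\<^sub>f a"
proof
  fix i
  have d: "dim_row (shear n a) = Suc n" "dim_col (shear n a) = Suc n"
    by (simp_all add: shear_def)
  show "mat_app (shear n a) x i = (x + x n *\<^sub>f a) i"
  proof (cases "i < Suc n")
    case True
    then have "mat_app (shear n a) x i = (\<Sum>j = 0..<Suc n. shear n a $$ (i, j) * x j)"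
      by (simp add: mat_app_def d scalar_prod_def)
    \<comment> \<open>At \<open>i = j = n\<close> both terms are present, and the second is 0
      because \<open>a n = 0\<close>.\<close>
    also have "\<dots> = (\<Sum>j = 0..<Suc n. (if i = j then x j else 0) + (if j = n then a i * x n else 0))"
      using True a by (intro sum.cong) (auto simp: shear_index Fq_def)
    also have "\<dots> = x i + a i * x n"
      using True by (simp only: sum.distrib) simp
    finally show ?thesis by (simp add: fscale_def)
  next
    case False
    then show ?thesis
      using x a by (simp add: mat_app_def d Fq_def fscale_def)
  qed
qed

text \<open>The matrix fixes \<open>Fq n\<close> pointwise and sends \<open>unitv n\<close> to
  \<open>unitv n + a\<close>.\<close>

lemma mat_app_shear_hat:
  assumes Z: "Z \<in> Bq n" and a: "a \<in> Fq n"
  shows "mat_app (shear n a) ` hat n Z = lift n a Z"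
proof -
  have *: "mat_app (shear n a) (z + t *\<^sub>f unitv n) = z + t *\<^sub>f (unitv n + a)" if "z \<in> Z" for z t
  proof -
    have z: "z \<in> Fq n" using that Z Bq_subset by blast
    then have "z + t *\<^sub>f unitv n \<in> Fq (Suc n)"
      using Fq_mono[of n "Suc n"] by (intro Fq_add Fq_scale) auto
    moreover have "(z + t *\<^sub>f unitv n) n = t"
      using z by (simp add: Fq_def fscale_def unitv_def)
    ultimately show ?thesis
      using mat_app_shear[OF _ a] by (simp add: fs.scale_right_distrib add.assoc)
  qed
  have hat: "x \<in> hat n Z \<longleftrightarrow> (\<exists>z\<in>Z. \<exists>t. x = z + t *\<^sub>f unitv n)" for x
    unfolding hat_eq_lift using mem_lift[OF Z, of x 0] by simp
  show ?thesis
  proof (rule Set.set_eqI)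
    fix x
    have "x \<in> mat_app (shear n a) ` hat n Z \<longleftrightarrow>
        (\<exists>z\<in>Z. \<exists>t. x = mat_app (shear n a) (z + t *\<^sub>f unitv n))"
      unfolding image_iff Bex_def hat by blast
    also have "\<dots> \<longleftrightarrow> x \<in> lift n a Z"
      by (simp add: * mem_lift[OF Z] cong: bex_cong)
    finally show "x \<in> mat_app (shear n a) ` hat n Z \<longleftrightarrow> x \<in> lift n a Z" .
  qed
qed

section \<open>Coordinates of \<open>pchi\<close> and the hyperplane attached to a character\<close>

lemma sum_fun_apply: "(\<Sum>i\<in>I. f i) x = (\<Sum>i\<in>I. f i x)"
  by (induction I rule: infinite_finite_induct) auto

lemma lin_ext_apply: "lin_ext S f v W = (\<Sum>Z\<in>S. v Z * f Z W)"
  by (simp add: lin_ext_def sum_fun_apply fscale_def)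

lemma lin_ext_bvec: "finite S \<Longrightarrow> Y \<in> S \<Longrightarrow> lin_ext S f (bvec Y) = f Y"
  by (rule ext) (simp add: lin_ext_apply bvec_def if_distrib[of "\<lambda>c. c * _"] cong: if_cong)

lemma Nq_char:
  assumes "\<chi> \<in> Nq n"
  shows "char_on (Fq n) (\<lambda>a. \<chi> (shear n a))"
proof -
  have h: "shear n a \<in> carrier (Hgrp n)" if "a \<in> Fq n" for a :: "'a cvec"
    using that bij_betw_shear bij_betwE by blast
  have \<chi>: "\<chi> \<in> hom (Hgrp n) Cstar" using assms by (simp add: Nq_def)
  show ?thesis
    unfolding char_on_def
  proof (intro conjI ballI)
    fix a b :: "'a cvec" assume "a \<in> Fq n" "b \<in> Fq n"
    then show "\<chi> (shear n (a + b)) = \<chi> (shear n a) * \<chi> (shear n b)"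
      using hom_mult[OF \<chi> h h] by (simp add: shear_add Hgrp_def Cstar_def)
  next
    fix a :: "'a cvec" assume "a \<in> Fq n"
    then show "\<chi> (shear n a) \<noteq> 0"
      using hom_in_carrier[OF \<chi> h] by (simp add: Cstar_def)
  qed
qed

lemma carrier_Hgrp: "carrier (Hgrp n) = shear n ` Fq n"
  by (rule bij_betw_imp_surj_on[OF bij_betw_shear, symmetric])

lemma Nq_nontrivial:
  assumes "\<chi> \<in> Nq n"
  obtains a where "a \<in> Fq n" "\<chi> (shear n a) \<noteq> 1"
  using assms by (auto simp: Nq_def carrier_Hgrp)

text \<open>Members of \<open>Nq n\<close> are extensional, so different ones already differ on the
  carrier, which \<open>shear n\<close> parametrises.\<close>

lemma Nq_separate:
  assumes "\<chi> \<in> Nq n" "\<chi>' \<in> Nq n" "\<chi> \<noteq> \<chi>'"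
  obtains a where "a \<in> Fq n" "\<chi> (shear n a) \<noteq> \<chi>' (shear n a)"
proof -
  have "\<exists>g\<in>carrier (Hgrp n). \<chi> g \<noteq> \<chi>' g"
    using assms extensionalityI[of \<chi> "carrier (Hgrp n)" \<chi>'] by (auto simp: Nq_def)
  then show ?thesis
    using that by (auto simp: carrier_Hgrp)
qed

lemma pchi_hat:
  fixes Y :: "'a::{finite,field} cvec set"
  assumes Y: "Y \<in> Bq n"
  shows "pchi n \<chi> (bvec (hat n Y)) W = (\<Sum>a\<in>Fq n. cnj (\<chi> (shear n a)) * bvec (lift n a Y) W)"
proof -
  have "hat n Y \<in> Aq n"
    using lift_in_Aq[OF Y, of 0] by (simp add: hat_eq_lift)
  then have "act n (shear n a) (bvec (hat n Y)) = bvec (lift n a Y)" if "a \<in> Fq n" for a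
    using that Y by (simp add: act_def lin_ext_bvec finite_Aq mat_app_shear_hat)
  then show ?thesis
    by (simp add: pchi_def sum_fun_apply fscale_def flip: sum.reindex_bij_betw[OF bij_betw_shear])
qed

lemma pchi_hat_outside:
  fixes Y :: "'a::{finite,field} cvec set"
  assumes "Y \<in> Bq n" "W \<notin> Aq n"
  shows "pchi n \<chi> (bvec (hat n Y)) W = 0"
  unfolding pchi_hat[OF assms(1)]
  using assms lift_in_Aq by (intro sum.neutral) (auto simp: bvec_def)

text \<open>The vectors \<open>b\<close> with \<open>lift n b Y = lift n a Y\<close> form the coset
  \<open>a + Y\<close>, and the character sum over this coset factors. It is nonzero exactly when
  \<open>\<chi>\<close> is trivial on \<open>Y\<close>.\<close>

lemma pchi_hat_lift:
  fixes Y :: "'a::{finite,field} cvec set"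
  assumes \<chi>: "\<chi> \<in> Nq n" and Y: "Y \<in> Bq n" and Z: "Z \<in> Bq n" and a: "a \<in> Fq n"
  shows "pchi n \<chi> (bvec (hat n Y)) (lift n a Z) =
    (if Y = Z then cnj (\<chi> (shear n a)) * (\<Sum>y\<in>Y. cnj (\<chi> (shear n y))) else 0)"
proof (cases "Y = Z")
  case False
  have "lift n a Z \<noteq> lift n b Y" if "b \<in> Fq n" for b
    using lift_Int_Fq[OF Z a] lift_Int_Fq[OF Y that] False by metis
  then have "(\<Sum>b\<in>Fq n. cnj (\<chi> (shear n b)) * bvec (lift n b Y) (lift n a Z)) = 0"
    by (intro sum.neutral) (simp add: bvec_def)
  then show ?thesis
    using False by (simp add: pchi_hat[OF Y])
next
  case True
  have "(\<Sum>b\<in>Fq n. cnj (\<chi> (shear n b)) * bvec (lift n b Y) (lift n a Z)) =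
      (\<Sum>b\<in>(+) a ` Y. cnj (\<chi> (shear n b)))"
  proof (rule sum.mono_neutral_cong_right[OF finite_Fq])
    show "(+) a ` Y \<subseteq> Fq n" using a Bq_subset[OF Y] by (auto intro!: Fq_add)
    have mem: "b \<in> (+) a ` Y \<longleftrightarrow> lift n b Y = lift n a Z" if "b \<in> Fq n" for b
      using that a True Y by (simp add: lift_eq_iff) (force simp: image_iff)
    then show "\<forall>b\<in>Fq n - (+) a ` Y. cnj (\<chi> (shear n b)) * bvec (lift n b Y) (lift n a Z) = 0"
      by (auto simp: bvec_def)
    show "cnj (\<chi> (shear n b)) * bvec (lift n b Y) (lift n a Z) = cnj (\<chi> (shear n b))"
      if "b \<in> (+) a ` Y" for b
      using mem[of b] that \<open>(+) a ` Y \<subseteq> Fq n\<close> by (auto simp: bvec_def)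
  qed
  also have "\<dots> = (\<Sum>y\<in>Y. cnj (\<chi> (shear n (a + y))))"
    by (subst sum.reindex) auto
  also have "\<dots> = cnj (\<chi> (shear n a)) * (\<Sum>y\<in>Y. cnj (\<chi> (shear n y)))"
    unfolding sum_distrib_left
  proof (rule sum.cong[OF refl])
    fix y assume "y \<in> Y"
    then have "y \<in> Fq n" using Bq_subset[OF Y] by blast
    then have "\<chi> (shear n (a + y)) = \<chi> (shear n a) * \<chi> (shear n y)"
      using Nq_char[OF \<chi>] a by (simp add: char_on_def)
    then show "cnj (\<chi> (shear n (a + y))) = cnj (\<chi> (shear n a)) * cnj (\<chi> (shear n y))"
      by simp
  qed
  finally show ?thesis
    using True unfolding pchi_hat[OF Y] by simp
qed

text \<open>The largest subspace on which \<open>\<chi>\<close> is trivial is a hyperplane, because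
  the characters induced on any two lines differ by a field multiplication
  (\<open>char_of_finite_field\<close>). A subspace with nonzero projection must lie in it, and
  equal dimension forces equality.\<close>

lemma Xchi:
  fixes \<chi> :: "'a::{finite,field} mat \<Rightarrow> complex"
  assumes \<chi>: "\<chi> \<in> Nq n"
  shows "Xchi n \<chi> \<in> Bq n" "fs.dim (Xchi n \<chi>) = n - 1" "\<forall>x\<in>Xchi n \<chi>. \<chi> (shear n x) = 1"
proof -
  define \<psi> where "\<psi> a = \<chi> (shear n a)" for a
  have \<psi>: "char_on (Fq n) \<psi>"
    using Nq_char[OF \<chi>] by (simp add: \<psi>_def[abs_def])
  have F: "add_subgroup (Fq n :: 'a cvec set)"
    by (intro add_subgroup_subspace subspace_Fq)
  obtain a0 where a0: "a0 \<in> Fq n" "\<psi> a0 \<noteq> 1"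
    using Nq_nontrivial[OF \<chi>] by (auto simp: \<psi>_def)
  have line: "char_on UNIV (\<lambda>t. \<psi> (t *\<^sub>f a))" if "a \<in> Fq n" for a
    using \<psi> that by (simp add: char_on_def Fq_scale fs.scale_left_distrib)
  \<comment> \<open>All multiples of \<open>a\<close> are tested: the kernel of
    \<open>\<psi>\<close> need not be closed under scalars when \<open>q\<close> is not
    prime.\<close>
  define X where "X = {a \<in> Fq n. \<forall>t. \<psi> (t *\<^sub>f a) = 1}"
  have subX: "fs.subspace X"
    unfolding fs.subspace_def
  proof (intro conjI ballI allI)
    show "0 \<in> X" using char_on_0[OF \<psi> F] by (simp add: X_def)
  next
    fix x y assume xy: "x \<in> X" "y \<in> X"
    then have "\<psi> (t *\<^sub>f (x + y)) = \<psi> (t *\<^sub>f x) * \<psi> (t *\<^sub>f y)" for t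
      using \<psi> by (simp add: char_on_def X_def Fq_scale fs.scale_right_distrib)
    then show "x + y \<in> X" using xy by (simp add: X_def Fq_add)
  next
    fix c x assume "x \<in> X"
    then show "c *\<^sub>f x \<in> X" by (simp add: X_def Fq_scale)
  qed
  have X: "X \<in> Bq n" using subX by (intro BqI) (auto simp: X_def)
  have a0X: "a0 \<notin> X"
    using a0 by (simp add: X_def) (metis fs.scale_one)
  have "fs.span (insert a0 X) = Fq n"
  proof
    show "fs.span (insert a0 X) \<subseteq> Fq n"
      using a0 by (intro fs.span_minimal subspace_Fq) (auto simp: X_def)
    show "Fq n \<subseteq> fs.span (insert a0 X)"
    proof
      fix a :: "'a cvec" assume a: "a \<in> Fq n"
      \<comment> \<open>With this \<open>c\<close>, the vectors \<open>a\<close> and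
        \<open>c a0\<close> induce the same character on the scalars, so their difference lies in
        \<open>X\<close>.\<close>
      obtain c :: 'a where c: "\<And>t. \<psi> (t *\<^sub>f a) = \<psi> ((c * t) *\<^sub>f a0)"
        using char_of_finite_field[OF line[OF a0(1)] _ line[OF a], of 1] a0 by auto
      have "\<psi> (t *\<^sub>f (a - c *\<^sub>f a0)) = 1" for t
      proof -
        have "\<psi> (t *\<^sub>f (a - c *\<^sub>f a0) + (c * t) *\<^sub>f a0) =
            \<psi> (t *\<^sub>f (a - c *\<^sub>f a0)) * \<psi> ((c * t) *\<^sub>f a0)"
          using \<psi> a a0 by (simp add: char_on_def Fq_scale Fq_diff)
        moreover have "t *\<^sub>f (a - c *\<^sub>f a0) + (c * t) *\<^sub>f a0 = t *\<^sub>f a"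
          by (simp add: fs.scale_right_diff_distrib mult.commute)
        moreover have "\<psi> ((c * t) *\<^sub>f a0) \<noteq> 0"
          using \<psi> a0 by (simp add: char_on_def Fq_scale)
        ultimately show ?thesis using c[of t] by simp
      qed
      then have "a - c *\<^sub>f a0 \<in> X"
        using a a0 by (simp add: X_def Fq_diff Fq_scale)
      then show "a \<in> fs.span (insert a0 X)"
        using mem_span_insert_subspace[OF subX] by (metis diff_add_cancel)
    qed
  qed
  then have "CARD('a) ^ n = CARD('a) * card X"
    using card_span_insert[OF subX a0X] by (simp add: card_Fq)
  then have cX: "CARD('a) ^ n = CARD('a) ^ Suc (fs.dim X)"
    using card_mem_Bq[OF X] by simp
  \<comment> \<open>This also shows that \<open>n\<close> is positive, so \<open>n - 1\<close> is a
    true difference.\<close>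
  then have "n = Suc (fs.dim X)"
    using CARD_field_gt_1[where 'a='a] power_inject_exp by blast
  then have dimX: "fs.dim X = n - 1" by simp
  have X1: "\<psi> x = 1" if "x \<in> X" for x
    using that by (simp add: X_def) (metis fs.scale_one)
  have "Xchi n \<chi> = X"
    unfolding Xchi_def
  proof (rule the_equality, intro conjI)
    have "pchi n \<chi> (bvec (hat n X)) (lift n 0 X) = of_nat (card X)"
      using X1 char_on_0[OF \<psi> F] by (simp add: pchi_hat_lift[OF \<chi> X X] \<psi>_def)
    then show "pchi n \<chi> (bvec (hat n X)) \<noteq> 0"
      using card_mem_Bq[OF X] by auto
  next
    fix Y :: "'a cvec set"
    assume Y: "Y \<in> Bq n \<and> fs.dim Y = n - 1 \<and> pchi n \<chi> (bvec (hat n Y)) \<noteq> 0"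
    have triv: "\<psi> y = 1" if "y \<in> Y" for y
    proof (rule ccontr)
      assume ny: "\<psi> y \<noteq> 1"
      \<comment> \<open>Nontriviality on \<open>Y\<close> kills the factor common to all coordinates
        of the projection.\<close>
      have s0: "(\<Sum>y\<in>Y. cnj (\<chi> (shear n y))) = 0"
      proof (rule sum_char_on[OF add_subgroup_subspace _ that])
        show "fs.subspace Y" using Y Bq_subspace by blast
        show "char_on Y (\<lambda>y. cnj (\<chi> (shear n y)))"
          using Y Nq_char[OF \<chi>] Bq_subset char_on_subset char_on_cnj by metis
        show "cnj (\<chi> (shear n y)) \<noteq> 1"
          using ny by (metis \<psi>_def complex_cnj_cnj complex_cnj_one)
      qed
      have "pchi n \<chi> (bvec (hat n Y)) W = 0" for W
      proof (cases "W \<in> Aq n")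
        case True
        then obtain a where "a \<in> Fq n" "W = lift n a (W \<inter> Fq n)" using Aq_ex_lift by blast
        moreover have "W \<inter> Fq n \<in> Bq n" using True by (rule Aq_Int_Fq)
        ultimately show ?thesis
          using pchi_hat_lift[OF \<chi>, of Y "W \<inter> Fq n" a] Y s0 by (metis mult_zero_right)
      next
        case False
        then show ?thesis using Y pchi_hat_outside by blast
      qed
      then show False using Y by (auto simp: fun_eq_iff)
    qed
    have "Y \<subseteq> X"
      using triv Y Bq_subset[of Y n] Bq_subspace[of Y n] by (auto simp: X_def fs.subspace_scale)
    moreover have "card Y = card X"
      using Y card_mem_Bq[of Y n] card_mem_Bq[OF X] dimX by simp
    ultimately show "Y = X"
      using card_subset_eq finite_mem_Bq[OF X] by blast
  qed (use X dimX in auto)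
  then show "Xchi n \<chi> \<in> Bq n" "fs.dim (Xchi n \<chi>) = n - 1" "\<forall>x\<in>Xchi n \<chi>. \<chi> (shear n x) = 1"
    using X dimX X1 by (auto simp: \<psi>_def)
qed

section \<open>Schubert normal form of hyperplanes\<close>

definition skip :: "nat \<Rightarrow> nat \<Rightarrow> nat"
  where "skip s j = (if j < s then j else Suc j)"

lemma skip_eq_iff [simp]: "skip s j = skip s k \<longleftrightarrow> j = k"
  and skip_neq [simp]: "skip s j \<noteq> s" "s \<noteq> skip s j"
  by (auto simp: skip_def)

lemma skip_less: "j < n - 1 \<Longrightarrow> skip s j < n"
  by (auto simp: skip_def)

lemma ex_skip: "i < n \<Longrightarrow> i \<noteq> s \<Longrightarrow> s < n \<Longrightarrow> \<exists>j<n - 1. i = skip s j"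
  by (cases "i < s", intro exI[of _ i], force simp: skip_def,
      intro exI[of _ "i - 1"], force simp: skip_def)

text \<open>The increasing map into \<open>{..<n}\<close> given by the pivot rows omits exactly one row \<open>s\<close>.\<close>

definition hyperplane_form :: "nat \<Rightarrow> nat \<Rightarrow> 'a::field mat \<Rightarrow> bool"
  where "hyperplane_form n s M \<longleftrightarrow> M \<in> carrier_mat n (n - 1) \<and> s < n \<and>
    (\<forall>j<n - 1. \<forall>k<n - 1. M $$ (skip s j, k) = (if j = k then 1 else 0)) \<and>
    (\<forall>j<n - 1. j < s \<longrightarrow> M $$ (s, j) = 0)"

text \<open>An increasing map from \<open>n - 1\<close> columns into \<open>n\<close> rows satisfies
  \<open>j \<le> r j \<le> j + 1\<close>, and once it has jumped it stays one ahead. The omitted row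
  \<open>s\<close> is the position of the jump.\<close>

lemma schubert_imp_hyperplane_form:
  assumes M: "M \<in> carrier_mat n (n - 1)" and n: "n > 0" and "schubert_normal_form M"
  shows "\<exists>s. hyperplane_form n s M"
proof -
  have d: "dim_row M = n" "dim_col M = n - 1" using M by auto
  obtain r where col: "\<forall>j<n - 1. r j < n \<and> M $$ (r j, j) = 1 \<and>
      (\<forall>i. r j < i \<and> i < n \<longrightarrow> M $$ (i, j) = 0)"
    and inc: "\<forall>j k. j < k \<and> k < n - 1 \<longrightarrow> r j < r k"
    and idm: "\<forall>j<n - 1. \<forall>k<n - 1. M $$ (r j, k) = (if j = k then 1 else 0)"
    using assms(3) unfolding schubert_normal_form_def d by blast
  have r: "r j < n" and last: "r j < i \<Longrightarrow> i < n \<Longrightarrow> M $$ (i, j) = 0" if "j < n - 1" for i j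
    using col that by auto
  have lower: "j \<le> r j" if "j < n - 1" for j
    using that
  proof (induction j)
    case (Suc j)
    then show ?case using inc[rule_format, of j "Suc j"] by simp
  qed simp
  have upper: "r j \<le> Suc j" if "j < n - 1" for j
  proof -
    \<comment> \<open>Induction backwards from the last column \<open>n - 2\<close>, with
      \<open>k\<close> the distance from it.\<close>
    have "k < n - 1 \<Longrightarrow> r (n - 2 - k) \<le> n - 1 - k" for k
    proof (induction k)
      case 0
      then have "n - 2 < n - 1" by simp
      from r[OF this] show ?case by simp
    next
      case (Suc k)
      then have "n - 2 - Suc k < n - 2 - k" and "n - 2 - k < n - 1" by auto
      then have "r (n - 2 - Suc k) < r (n - 2 - k)" using inc by blast
      moreover have "r (n - 2 - k) \<le> n - 1 - k" using Suc by simp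
      ultimately show ?case by linarith
    qed
    moreover have "n - 2 - j < n - 1" "n - 2 - (n - 2 - j) = j" "n - 1 - (n - 2 - j) = Suc j"
      using that by auto
    ultimately show ?thesis by metis
  qed
  \<comment> \<open>The disjunct \<open>j = n - 1\<close> makes the minimum exist and covers the
    case without a jump, where the last row is omitted.\<close>
  define s where "s = (LEAST j. j = n - 1 \<or> r j \<noteq> j)"
  have s: "s = n - 1 \<or> r s \<noteq> s" "s \<le> n - 1"
    unfolding s_def by (rule LeastI[of _ "n - 1"], simp) (rule Least_le, simp)
  have below: "r j = j" if "j < s" for j
    using not_less_Least[OF that[unfolded s_def]] by blast
  have above: "j < n - 1 \<Longrightarrow> s \<le> j \<Longrightarrow> Suc j \<le> r j" for j
  proof (induction j)
    case 0
    then show ?case using s by auto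
  next
    case (Suc j)
    show ?case
    proof (cases "s = Suc j")
      case True
      then show ?thesis using s lower[of s] Suc.prems by auto
    next
      case False
      then show ?thesis using Suc inc[rule_format, of j "Suc j"] by simp
    qed
  qed
  have "r j = skip s j" if "j < n - 1" for j
    using below[of j] above[of j] upper[of j] that by (auto simp: skip_def)
  then have "hyperplane_form n s M"
    using M idm last s n below by (auto simp: hyperplane_form_def)
  then show ?thesis ..
qed

text \<open>The pivot map is \<open>skip s\<close>. Below the pivot of column \<open>j\<close> lie
  identity rows of other columns and possibly row \<open>s\<close>; the latter only if
  \<open>j < s\<close>, where the form prescribes 0.\<close>

lemma hyperplane_form_imp_schubert:
  assumes "hyperplane_form n s M"
  shows "schubert_normal_form M"
  unfolding schubert_normal_form_def
proof (intro exI[of _ "skip s"] conjI allI impI)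
  have M: "dim_row M = n" "dim_col M = n - 1" and s: "s < n"
    using assms by (auto simp: hyperplane_form_def)
  have idm: "M $$ (skip s j, k) = (if j = k then 1 else 0)" if "j < n - 1" "k < n - 1" for j k
    using assms that by (auto simp: hyperplane_form_def)
  show "skip s j < dim_row M" "M $$ (skip s j, j) = 1" if "j < dim_col M" for j
    using that M idm skip_less by auto
  show "M $$ (skip s j, k) = (if j = k then 1 else 0)" if "j < dim_col M" "k < dim_col M" for j k
    using that M idm by auto
  show "skip s j < skip s k" if "j < k \<and> k < dim_col M" for j k
    using that by (auto simp: skip_def)
  fix i j assume ij: "j < dim_col M" "skip s j < i \<and> i < dim_row M"
  show "M $$ (i, j) = 0"
  proof (cases "i = s")
    case True
    then have "j < s" using ij by (auto simp: skip_def split: if_splits)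
    then show ?thesis using assms True ij M by (auto simp: hyperplane_form_def)
  next
    case False
    then obtain k where "k < n - 1" "i = skip s k"
      using ex_skip[of i n s] s ij M by auto
    then show ?thesis using idm ij M by auto
  qed
qed

lemma col_vec_skip:
  assumes "hyperplane_form n s M" "j < n - 1" "k < n - 1"
  shows "col_vec M k (skip s j) = (if j = k then 1 else 0)"
  using assms skip_less[of j n s] by (auto simp: hyperplane_form_def col_vec_def)

text \<open>The pivot rows form the identity, so they return the coefficients of a combination of
  columns. This makes \<open>tau\<close> injective.\<close>

lemma combination_skip:
  assumes "hyperplane_form n s M" "j < n - 1"
  shows "(\<Sum>k<n - 1. x k *\<^sub>f col_vec M k) (skip s j) = x j"
proof -
  have "(\<Sum>k<n - 1. x k *\<^sub>f col_vec M k) (skip s j) = (\<Sum>k<n - 1. if j = k then x k else 0)"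
    unfolding sum_fun_apply using assms
    by (intro sum.cong) (auto simp: fscale_def col_vec_skip)
  then show ?thesis using assms(2) by simp
qed

lemma col_vec_in_col_span: "j < dim_col M \<Longrightarrow> col_vec M j \<in> col_span M"
  by (simp add: col_span_def fs.span_base)

text \<open>This is the equation of the hyperplane. Both sides are linear in \<open>x\<close>, and
  for a column the pivot entries select a single term.\<close>

lemma col_span_omitted_row:
  assumes M: "hyperplane_form n s M" and x: "x \<in> col_span M"
  shows "x s = (\<Sum>k<n - 1. x (skip s k) * M $$ (s, k))"
  using x unfolding col_span_def
proof (induction rule: fs.span_induct_alt)
  case base
  then show ?case by simp
next
  case (step c y z)
  have d: "dim_row M = n" "dim_col M = n - 1" "s < n"
    using M by (auto simp: hyperplane_form_def)
  obtain j where j: "j < n - 1" "y = col_vec M j"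
    using step d by auto
  have "(\<Sum>k<n - 1. y (skip s k) * M $$ (s, k)) = (\<Sum>k<n - 1. if k = j then M $$ (s, k) else 0)"
    using j M by (intro sum.cong) (auto simp: col_vec_skip)
  also have "\<dots> = y s" using j d by (simp add: col_vec_def)
  finally have "y s = (\<Sum>k<n - 1. y (skip s k) * M $$ (s, k))" ..
  with step show ?case
    by (simp add: fscale_def distrib_right sum.distrib sum_distrib_left mult.assoc)
qed

text \<open>\<open>unitv s\<close> violates the equation of the hyperplane, while column
  \<open>i\<close> is \<open>unitv i\<close> for \<open>i < s\<close>. Hence \<open>s\<close>
  depends only on the column space.\<close>

lemma hyperplane_form_least:
  assumes M: "hyperplane_form n s M"
  shows "unitv s \<notin> col_span M" and "i < s \<Longrightarrow> unitv i \<in> col_span M"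
proof -
  have d: "dim_row M = n" "dim_col M = n - 1" "s < n"
    using M by (auto simp: hyperplane_form_def)
  have "(\<Sum>k<n - 1. unitv s (skip s k) * M $$ (s, k)) = 0"
    by (intro sum.neutral) (simp add: unitv_def)
  then show "unitv s \<notin> col_span M"
    using col_span_omitted_row[OF M, of "unitv s"] by (auto simp: unitv_def)
  assume i: "i < s"
  have "col_vec M i = unitv i"
  proof
    fix l
    consider "l \<ge> n" | "l = s" | k where "k < n - 1" "l = skip s k"
      using ex_skip[of l n s] d by force
    then show "col_vec M i l = unitv i l"
    proof cases
      case 3
      then show ?thesis
        using i d col_vec_skip[OF M, of k i] by (auto simp: unitv_def skip_def split: if_splits)
    qed (use i d M in \<open>auto simp: col_vec_def unitv_def hyperplane_form_def\<close>)
  qed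
  then show "unitv i \<in> col_span M"
    using i d col_vec_in_col_span[of i M] by auto
qed

text \<open>The column space fixes \<open>s\<close>, the pivot rows are the identity, and row
  \<open>s\<close> is recovered by putting the columns of \<open>N\<close> into the hyperplane
  equation of \<open>M\<close>.\<close>

lemma hyperplane_form_unique:
  assumes M: "hyperplane_form n s M" and N: "hyperplane_form n t N"
    and span: "col_span M = col_span N"
  shows "M = N"
proof -
  have st: "s = t"
    using hyperplane_form_least[OF M] hyperplane_form_least[OF N] span
    by (metis linorder_neqE_nat)
  have d: "M \<in> carrier_mat n (n - 1)" "N \<in> carrier_mat n (n - 1)" "s < n"
    using M N by (auto simp: hyperplane_form_def)
  show ?thesis
  proof (rule eq_matI)
    fix i j assume "i < dim_row N" "j < dim_col N"
    then have ij: "i < n" "j < n - 1" using d by auto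
    show "M $$ (i, j) = N $$ (i, j)"
    proof (cases "i = s")
      case True
      have "col_vec N j s = (\<Sum>k<n - 1. col_vec N j (skip s k) * M $$ (s, k))"
        using col_span_omitted_row[OF M, of "col_vec N j"] col_vec_in_col_span[of j N] ij d span
        by auto
      also have "\<dots> = (\<Sum>k<n - 1. if k = j then M $$ (s, k) else 0)"
        using ij N st by (intro sum.cong) (auto simp: col_vec_skip)
      also have "\<dots> = M $$ (s, j)" using ij by simp
      finally show ?thesis using True d by (simp add: col_vec_def)
    next
      case False
      then obtain k where "k < n - 1" "i = skip s k"
        using ex_skip[of i n s] ij d by auto
      then show ?thesis using M N st ij by (simp add: hyperplane_form_def)
    qed
  qed (use d in auto)
qed

text \<open>Let \<open>s\<close> be least with \<open>unitv s\<close> outside \<open>X\<close>.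
  Modulo \<open>X\<close> every other unit vector is a multiple of \<open>unitv s\<close>, and the
  corrected unit vectors are the columns.\<close>

lemma hyperplane_form_exists:
  fixes X :: "'a::{finite,field} cvec set"
  assumes X: "X \<in> Bq n" and dim: "fs.dim X = n - 1" and n: "n > 0"
  shows "\<exists>s M. hyperplane_form n s M \<and> col_span M = X"
proof -
  have subX: "fs.subspace X" and XF: "X \<subseteq> Fq n"
    using Bq_subspace[OF X] Bq_subset[OF X] by auto
  have cX: "card X * CARD('a) = CARD('a) ^ n"
    using n by (simp add: card_mem_Bq[OF X] dim flip: power_Suc2)
  have sumX: "(\<Sum>k<m. y k *\<^sub>f z k) \<in> X" if "\<And>k. k < m \<Longrightarrow> z k \<in> X" for y and z :: "nat \<Rightarrow> 'a cvec" and m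
    using that by (intro fs.subspace_sum subX) (auto intro: fs.subspace_scale subX)
  \<comment> \<open>A hyperplane has too few elements to contain all these unit vectors.\<close>
  have ex: "\<exists>i<n. unitv i \<notin> X"
  proof (rule ccontr)
    assume neg: "\<not> ?thesis"
    have "Fq n \<subseteq> X"
    proof
      fix x :: "'a cvec" assume x: "x \<in> Fq n"
      have "x = (\<Sum>k<n. x k *\<^sub>f unitv k)"
      proof
        fix i
        have "(\<Sum>k<n. x k *\<^sub>f unitv k) i = (\<Sum>k<n. if i = k then x k else 0)"
          unfolding sum_fun_apply by (intro sum.cong) (auto simp: fscale_def unitv_def)
        then show "x i = (\<Sum>k<n. x k *\<^sub>f unitv k) i"
          using x by (auto simp: Fq_def)
      qed
      then show "x \<in> X" using neg sumX[of n unitv x] by auto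
    qed
    then have "card X = CARD('a) ^ n" using XF card_Fq[where 'a='a, of n] by auto
    then show False using cX CARD_field_gt_1[where 'a='a] by auto
  qed
  define s where "s = (LEAST i. unitv i \<notin> X)"
  have s: "s < n" "unitv s \<notin> X"
    using ex LeastI[of "\<lambda>i. unitv i \<notin> X"] Least_le[of "\<lambda>i. unitv i \<notin> X"] unfolding s_def
    by (auto intro: le_less_trans)
  have below: "unitv i \<in> X" if "i < s" for i
    using not_less_Least[OF that[unfolded s_def]] by blast
  have "fs.span (insert (unitv s) X) = Fq n"
  proof (rule card_subset_eq[OF finite_Fq])
    show "fs.span (insert (unitv s) X) \<subseteq> Fq n"
      using s XF by (intro fs.span_minimal subspace_Fq) auto
    show "card (fs.span (insert (unitv s) X)) = card (Fq n :: 'a cvec set)"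
      using cX by (simp add: card_span_insert[OF subX s(2)] card_Fq mult.commute)
  qed
  then have "\<exists>t. unitv i + t *\<^sub>f unitv s \<in> X" if "i < n" for i
    using that mem_span_insert_subspace[OF subX, of "unitv i" "unitv s"]
    by (auto simp: add.assoc simp flip: fs.scale_left_distrib)
       (metis add.right_neutral add.right_inverse fs.scale_zero_left)
  then obtain d0 where d0: "unitv i + d0 i *\<^sub>f unitv s \<in> X" if "i < n" for i
    by metis
  \<comment> \<open>The correction can be 0 for \<open>i < s\<close>, since \<open>unitv i\<close>
    is then in \<open>X\<close>; this gives the zeros that the form requires in row
    \<open>s\<close>.\<close>
  define d where "d i = (if i < s then 0 else d0 i)" for i
  have d: "unitv i + d i *\<^sub>f unitv s \<in> X" if "i < n" for i
    using d0[OF that] below[of i] by (simp add: d_def)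
  define M where "M = mat n (n - 1) (\<lambda>(i, j).
    if i = skip s j then 1 else if i = s then d (skip s j) else 0)"
  have dims: "dim_row M = n" "dim_col M = n - 1" by (simp_all add: M_def)
  have M: "hyperplane_form n s M"
    using s skip_less[of _ n s] by (auto simp: hyperplane_form_def M_def d_def skip_def)
  have col: "col_vec M j \<in> X" if "j < n - 1" for j
  proof -
    have "col_vec M j = unitv (skip s j) + d (skip s j) *\<^sub>f unitv s"
      using that s skip_less[OF that, of s]
      by (auto simp: col_vec_def M_def unitv_def fscale_def fun_eq_iff)
    then show ?thesis using d[OF skip_less[OF that]] by simp
  qed
  have "col_span M = X"
  proof
    show "col_span M \<subseteq> X"
      unfolding col_span_def using col dims by (intro fs.span_minimal subX) auto
    show "X \<subseteq> col_span M"
    proof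
      fix x assume x: "x \<in> X"
      let ?c = "\<Sum>k<n - 1. x (skip s k) *\<^sub>f col_vec M k"
      let ?y = "x - ?c"
      \<comment> \<open>\<open>y\<close> vanishes in all pivot rows, so it is a multiple of
        \<open>unitv s\<close>. It lies in \<open>X\<close>, which does not contain
        \<open>unitv s\<close>, so it is 0.\<close>
      define y where "y = x - ?c"
      have "?c \<in> X" using col by (rule sumX)
      then have y: "y \<in> X" unfolding y_def using x subX by (intro fs.subspace_diff)
      have "y i = (y s *\<^sub>f unitv s) i" for i
      proof -
        consider "i \<ge> n" | "i = s" | k where "k < n - 1" "i = skip s k"
          using ex_skip[of i n s] s by force
        then show ?thesis
        proof cases
          case 1
          have "y \<in> Fq n" using y XF by blast
          with 1 s show ?thesis by (simp add: Fq_def fscale_def unitv_def)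
        next
          case 2
          then show ?thesis by (simp add: fscale_def unitv_def)
        next
          case 3
          then have "y i = 0"
            using combination_skip[OF M 3(1), of "\<lambda>k. x (skip s k)"] by (simp add: y_def)
          with 3 show ?thesis
            by (simp add: fscale_def unitv_def)
        qed
      qed
      then have ys: "y = y s *\<^sub>f unitv s" by (rule ext)
      have "y s = 0"
      proof (rule ccontr)
        assume "y s \<noteq> 0"
        then have "unitv s = inverse (y s) *\<^sub>f (y s *\<^sub>f unitv s)" by simp
        also have "\<dots> \<in> X" using fs.subspace_scale[OF subX y] ys by simp
        finally show False using s(2) by blast
      qed
      then have "y = 0" by (subst ys) simp
      then have "x = ?c" by (simp add: y_def)
      also have "?c \<in> col_span M"
        unfolding col_span_def using dims
        by (intro fs.span_sum fs.span_scale fs.span_base) auto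
      finally show "x \<in> col_span M" .
    qed
  qed
  with M show ?thesis by blast
qed

text \<open>Existence and uniqueness of the normal form make the definite description in
  \<open>Mmat\<close> denote it.\<close>

lemma Mmat_hyperplane_form:
  fixes X :: "'a::{finite,field} cvec set"
  assumes "X \<in> Bq n" and "fs.dim X = n - 1" and n: "n > 0"
  obtains s where "hyperplane_form n s (Mmat n X)" "col_span (Mmat n X) = X"
proof -
  obtain s M where M: "hyperplane_form n s M" "col_span M = X"
    using hyperplane_form_exists[OF assms] by blast
  have "Mmat n X = M"
    unfolding Mmat_def
  proof (rule the_equality)
    show "M \<in> carrier_mat n (n - 1) \<and> schubert_normal_form M \<and> col_span M = X"
      using M hyperplane_form_imp_schubert by (auto simp: hyperplane_form_def)
  next
    fix N assume "N \<in> carrier_mat n (n - 1) \<and> schubert_normal_form N \<and> col_span N = X"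
    then show "N = M"
      using schubert_imp_hyperplane_form[OF _ n, of N] hyperplane_form_unique[OF _ M(1)] M(2)
      by metis
  qed
  with M that[of s] show ?thesis by simp
qed

text \<open>\<open>tau\<close> is linear, and the pivot rows of its value return the argument.
  Dimensions agree because an injective image has the same cardinality.\<close>

lemma
  fixes X Y :: "'a::{finite,field} cvec set"
  assumes X: "X \<in> Bq n" "fs.dim X = n - 1" "n > 0"
  shows inj_on_tau: "inj_on (tau n X) (Fq (n - 1))"
    and tau_in_subspaces_of: "Y \<in> Bq (n - 1) \<Longrightarrow> tau n X ` Y \<in> subspaces_of X"
    and dim_tau: "Y \<in> Bq (n - 1) \<Longrightarrow> fs.dim (tau n X ` Y) = fs.dim Y"
proof -
  let ?M = "Mmat n X" let ?t = "tau n X"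
  obtain s where M: "hyperplane_form n s ?M" "col_span ?M = X"
    using Mmat_hyperplane_form[OF X] by blast
  have dims: "dim_col ?M = n - 1" using M by (auto simp: hyperplane_form_def)
  show inj: "inj_on ?t (Fq (n - 1))"
  proof (rule inj_onI)
    fix x y :: "'a cvec" assume xy: "x \<in> Fq (n - 1)" "y \<in> Fq (n - 1)" "?t x = ?t y"
    show "x = y"
    proof
      fix j
      show "x j = y j"
      proof (cases "j < n - 1")
        case True
        then show ?thesis
          using combination_skip[OF M(1) True, of x] combination_skip[OF M(1) True, of y] xy(3)
          by (simp add: tau_def)
      qed (use xy in \<open>simp add: Fq_def\<close>)
    qed
  qed
  have add: "?t (x + y) = ?t x + ?t y" for x y
    by (simp add: tau_def fs.scale_left_distrib sum.distrib)
  have scale: "?t (c *\<^sub>f x) = c *\<^sub>f ?t x" for c x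
    by (simp add: tau_def fs.scale_sum_right) (simp add: fscale_def[of c x])
  have inX: "?t x \<in> X" for x
  proof -
    have "?t x \<in> col_span ?M"
      unfolding tau_def col_span_def using dims
      by (intro fs.span_sum fs.span_scale fs.span_base) auto
    then show ?thesis using M by simp
  qed
  assume Y: "Y \<in> Bq (n - 1)"
  have "fs.subspace (?t ` Y)"
    unfolding fs.subspace_def
  proof (intro conjI ballI allI)
    have "?t 0 = 0" by (simp add: tau_def)
    then show "0 \<in> ?t ` Y"
      using fs.subspace_0[OF Bq_subspace[OF Y]] by (metis image_eqI)
  next
    fix x y assume "x \<in> ?t ` Y" "y \<in> ?t ` Y"
    then show "x + y \<in> ?t ` Y"
      using fs.subspace_add[OF Bq_subspace[OF Y]] by (auto simp flip: add)
  next
    fix c x assume "x \<in> ?t ` Y"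
    then show "c *\<^sub>f x \<in> ?t ` Y"
      using fs.subspace_scale[OF Bq_subspace[OF Y]] by (auto simp flip: scale)
  qed
  then show tX: "?t ` Y \<in> subspaces_of X"
    using inX by (auto simp: subspaces_of_def)
  then have "?t ` Y \<in> Bq n"
    using Bq_subset[OF X(1)] by (auto simp: subspaces_of_def Bq_def)
  moreover have "card (?t ` Y) = card Y"
    using inj Bq_subset[OF Y] by (intro card_image) (rule inj_on_subset)
  ultimately show "fs.dim (?t ` Y) = fs.dim Y"
    using card_mem_Bq[OF Y] by (intro dim_eqI) auto
qed

section \<open>Orthogonality\<close>

lemma mem_Aq_iff: "W \<in> Aq n \<longleftrightarrow> W \<in> Bq (Suc n) \<and> W \<notin> Bq n"
  by (auto simp: Aq_def Bq_def subspaces_of_def)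

lemma Bq_Suc: "Bq (Suc n) = Bq n \<union> Aq n"
  using Fq_mono[of n "Suc n"] by (auto simp: Aq_def Bq_def subspaces_of_def)

lemma subspaces_of_subset_Bq: "X \<in> Bq n \<Longrightarrow> subspaces_of X \<subseteq> Bq n"
  by (auto simp: subspaces_of_def Bq_def)

lemma theta_outside: "W \<notin> Aq n \<Longrightarrow> theta n u W = 0"
  by (auto simp: theta_def lin_ext_apply sum_fun_apply bvec_def intro!: sum.neutral)

lemma theta_lift:
  fixes Z :: "'a::{finite,field} cvec set"
  assumes Z: "Z \<in> Bq n" and a: "a \<in> Fq n"
  shows "theta n u (lift n a Z) = u Z"
proof -
  have "(\<Sum>Y | Y \<in> Aq n \<and> Y \<inter> Fq n = V. bvec Y) (lift n a Z) = (if V = Z then 1 else 0)" for V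
    unfolding sum_fun_apply bvec_def
    using lift_in_Aq[OF assms] lift_Int_Fq[OF assms] finite_Aq[where 'a='a, of n]
    by (simp add: sum.delta')
  then have "theta n u (lift n a Z) = (\<Sum>V\<in>Bq n. if V = Z then u V else 0)"
    by (simp add: theta_def lin_ext_apply if_distrib[of "\<lambda>c. _ * c"] cong: if_cong)
  then show ?thesis using Z by (simp add: finite_Bq)
qed

lemma mu_outside:
  assumes "Z \<notin> (`) (tau n X) ` Bq (n - 1)"
  shows "mu n X v Z = 0"
proof -
  have "bvec (tau n X ` Y) Z = 0" if "Y \<in> Bq (n - 1)" for Y
    using assms that by (force simp: bvec_def)
  then show ?thesis by (simp add: mu_def lin_ext_apply)
qed

lemma inj_on_image_tau:
  fixes X :: "'a::{finite,field} cvec set"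
  assumes "X \<in> Bq n" "fs.dim X = n - 1" "n > 0"
  shows "inj_on ((`) (tau n X)) (Bq (n - 1))"
proof (rule inj_onI)
  fix Y Y' :: "'a cvec set"
  assume Y: "Y \<in> Bq (n - 1)" "Y' \<in> Bq (n - 1)" "tau n X ` Y = tau n X ` Y'"
  then show "Y = Y'"
    using inj_on_image_eq_iff[OF inj_on_tau[OF assms] Bq_subset[OF Y(1)] Bq_subset[OF Y(2)]] by simp
qed

lemma mu_tau:
  fixes X :: "'a::{finite,field} cvec set"
  assumes X: "X \<in> Bq n" "fs.dim X = n - 1" "n > 0" and Y: "Y \<in> Bq (n - 1)"
  shows "mu n X v (tau n X ` Y) = v Y"
proof -
  have "mu n X v (tau n X ` Y) = (\<Sum>V\<in>Bq (n - 1). if V = Y then v V else 0)"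
    unfolding mu_def lin_ext_apply
    by (intro sum.cong) (simp_all add: bvec_def inj_on_eq_iff[OF inj_on_image_tau[OF X] Y])
  then show ?thesis using Y by (simp add: finite_Bq)
qed

lemma lam_outside:
  fixes \<chi> :: "'a::{finite,field} mat \<Rightarrow> complex"
  assumes \<chi>: "\<chi> \<in> Nq n" and W: "W \<notin> Aq n"
  shows "lam n \<chi> v W = 0"
proof -
  have "pchi n \<chi> (bvec (hat n Y)) W = 0" if "Y \<in> subspaces_of (Xchi n \<chi>)" for Y
    using that subspaces_of_subset_Bq[OF Xchi(1)[OF \<chi>]] W by (intro pchi_hat_outside) auto
  then show ?thesis
    by (simp add: lam_def lin_ext_apply fscale_def)
qed

text \<open>For \<open>Y\<close> inside \<open>Xchi n \<chi>\<close> the character sum in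
  \<open>pchi_hat_lift\<close> is \<open>card Y\<close>, which the factor
  \<open>q ^ (- dim Y)\<close> of \<open>lam\<close> cancels.\<close>

lemma lam_lift:
  fixes \<chi> :: "'a::{finite,field} mat \<Rightarrow> complex"
  assumes \<chi>: "\<chi> \<in> Nq n" and Z: "Z \<in> Bq n" and a: "a \<in> Fq n"
  shows "lam n \<chi> v (lift n a Z) =
    (if Z \<subseteq> Xchi n \<chi> then v Z * cnj (\<chi> (shear n a)) else 0)"
proof -
  let ?X = "Xchi n \<chi>"
  have XB: "subspaces_of ?X \<subseteq> Bq n"
    by (intro subspaces_of_subset_Bq Xchi(1) \<chi>)
  have "((1 / of_nat CARD('a) ^ fs.dim Y) *\<^sub>f pchi n \<chi> (bvec (hat n Y))) (lift n a Z) =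
      (if Y = Z then cnj (\<chi> (shear n a)) else 0)" if Y: "Y \<in> subspaces_of ?X" for Y
  proof -
    have YB: "Y \<in> Bq n" using Y XB by blast
    have "(\<Sum>y\<in>Y. cnj (\<chi> (shear n y))) = (\<Sum>y\<in>Y. 1)"
      using Y Xchi(3)[OF \<chi>] by (intro sum.cong) (auto simp: subspaces_of_def)
    also have "\<dots> = of_nat CARD('a) ^ fs.dim Y"
      by (simp add: card_mem_Bq[OF YB])
    finally show ?thesis
      using pchi_hat_lift[OF \<chi> YB Z a] by (auto simp: fscale_def)
  qed
  then have "lam n \<chi> v (lift n a Z) =
      (\<Sum>Y\<in>subspaces_of ?X. if Y = Z then v Z * cnj (\<chi> (shear n a)) else 0)"
    unfolding lam_def lin_ext_apply by (intro sum.cong) auto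
  moreover have "Z \<in> subspaces_of ?X \<longleftrightarrow> Z \<subseteq> ?X"
    using Bq_subspace[OF Z] by (simp add: subspaces_of_def)
  moreover have "finite (subspaces_of ?X)"
    using XB finite_Bq finite_subset by blast
  ultimately show ?thesis by simp
qed

text \<open>The image of \<open>mu\<close> is supported on subspaces of
  \<open>Xchi n \<chi>\<close>, so the case distinction of \<open>lam_lift\<close>
  disappears.\<close>

lemma lam_mu_lift:
  fixes \<chi> :: "'a::{finite,field} mat \<Rightarrow> complex"
  assumes \<chi>: "\<chi> \<in> Nq n" and n: "n > 0" and Z: "Z \<in> Bq n" and a: "a \<in> Fq n"
  shows "lam n \<chi> (mu n (Xchi n \<chi>) v) (lift n a Z) =
    mu n (Xchi n \<chi>) v Z * cnj (\<chi> (shear n a))"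
proof -
  note X = Xchi(1,2)[OF \<chi>]
  have "mu n (Xchi n \<chi>) v Z = 0" if "\<not> Z \<subseteq> Xchi n \<chi>"
    using that tau_in_subspaces_of[OF X n] by (intro mu_outside) (auto simp: subspaces_of_def)
  then show ?thesis by (simp add: lam_lift[OF \<chi> Z a])
qed

section \<open>The inner product without normalisation and its recursion\<close>

definition weighted_inner :: "nat \<Rightarrow> 'a::{finite,field} comb \<Rightarrow> 'a comb \<Rightarrow> complex"
  where "weighted_inner n u v =
    (\<Sum>X\<in>Bq n. cnj (u X) * v X * of_nat CARD('a) ^ (fs.dim X choose 2))"

text \<open>The normalising constant depends on \<open>n\<close> alone and factors out, which keeps
  it out of the comparison of different levels.\<close>

lemma inner_q_eq: "inner_q n u v = weighted_inner n u v / Pq CARD('a) n"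
  for u v :: "'a::{finite,field} comb"
  by (simp add: inner_q_def weighted_inner_def sum_divide_distrib)

lemma weighted_inner_commute: "weighted_inner n v u = cnj (weighted_inner n u v)"
  by (simp add: weighted_inner_def mult.commute)

text \<open>
  Each \<open>W \<in> Aq n\<close> with \<open>W \<inter> Fq n = Z\<close> equals \<open>lift n a Z\<close> for \<open>q ^ dim Z\<close> vectors \<open>a\<close>, and
  this multiplicity cancels against \<open>(d + 1 choose 2) = (d choose 2) + d\<close>.
\<close>

lemma weighted_inner_Suc:
  fixes u v :: "'a::{finite,field} comb"
  shows "weighted_inner (Suc n) u v = weighted_inner n u v +
    (\<Sum>Z\<in>Bq n. (\<Sum>a\<in>Fq n. cnj (u (lift n a Z)) * v (lift n a Z)) *
      of_nat CARD('a) ^ (fs.dim Z choose 2))"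
proof -
  let ?q = "of_nat CARD('a) :: complex"
  have q: "?q \<noteq> 0" by simp
  let ?f = "\<lambda>W. cnj (u W) * v W * ?q ^ (fs.dim W choose 2)"
  have "(\<Sum>W\<in>Aq n. ?f W) = (\<Sum>Z\<in>Bq n. (\<Sum>a\<in>Fq n. ?f (lift n a Z)) / of_nat (card Z))"
    by (rule sum_Aq)
  also have "\<dots> = (\<Sum>Z\<in>Bq n. (\<Sum>a\<in>Fq n. cnj (u (lift n a Z)) * v (lift n a Z)) *
      ?q ^ (fs.dim Z choose 2))"
  proof (rule sum.cong[OF refl])
    fix Z :: "'a cvec set" assume Z: "Z \<in> Bq n"
    have "?q ^ (Suc (fs.dim Z) choose 2) = ?q ^ (fs.dim Z choose 2) * ?q ^ fs.dim Z"
      by (simp add: numeral_2_eq_2 power_add mult.commute)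
    then have "(\<Sum>a\<in>Fq n. ?f (lift n a Z)) =
        (\<Sum>a\<in>Fq n. cnj (u (lift n a Z)) * v (lift n a Z)) *
          ?q ^ (fs.dim Z choose 2) * ?q ^ fs.dim Z"
      using Z by (simp add: dim_lift sum_distrib_right mult.assoc)
    then show "(\<Sum>a\<in>Fq n. ?f (lift n a Z)) / of_nat (card Z) =
        (\<Sum>a\<in>Fq n. cnj (u (lift n a Z)) * v (lift n a Z)) * ?q ^ (fs.dim Z choose 2)"
      by (simp add: card_mem_Bq[OF Z])
  qed
  finally show ?thesis
    unfolding weighted_inner_def Bq_Suc
    by (subst sum.union_disjoint) (auto simp: finite_Bq finite_Aq mem_Aq_iff)
qed

section \<open>Last entries, supports and entry counts of the basis vectors\<close>

lemma basis_vec_Zero: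
  "basis_vec (Suc (Suc n)) (\<beta> @ [Zero]) =
    (of_nat CARD('a) ^ Nnz \<beta>) *\<^sub>f basis_vec (Suc n) \<beta> + theta (Suc n) (basis_vec (Suc n) \<beta>)"
  and basis_vec_One:
  "basis_vec (Suc (Suc n)) (\<beta> @ [One]) =
    (of_nat CARD('a) ^ (Suc n - Nnz \<beta>)) *\<^sub>f basis_vec (Suc n) \<beta> - theta (Suc n) (basis_vec (Suc n) \<beta>)"
  and basis_vec_Chi:
  "basis_vec (Suc (Suc n)) (\<beta> @ [Chi \<chi>]) =
    lam (Suc n) \<chi> (mu (Suc n) (Xchi (Suc n) \<chi>) (basis_vec n \<beta>))"
  for \<beta> :: "'a::{finite,field} entry list"
  by (simp_all add: Let_def)

lemma Fq_1_in_Bq: "Fq (Suc 0) \<in> Bq (Suc 0)"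
  by (simp add: BqI subspace_Fq)

lemma zero_in_Bq: "{0} \<in> Bq n"
  by (simp add: BqI fs.subspace_single_0)

text \<open>Membership in \<open>C[Bq n]\<close> means vanishing elsewhere. Values of
  \<open>lam\<close> and \<open>theta\<close> are supported in \<open>Aq\<close>, and the prefix
  vector of an entry 0 or 1 is supported one level lower.\<close>

lemma basis_vec_support:
  fixes \<alpha> :: "'a::{finite,field} entry list"
  shows "\<alpha> \<in> Eq n \<Longrightarrow> X \<notin> Bq n \<Longrightarrow> basis_vec n \<alpha> X = 0"
proof (induction n arbitrary: \<alpha> rule: induct_nat_012[case_names zero one step])
  case zero
  then show ?case using zero_in_Bq[where 'a='a, of 0] by (auto simp: bvec_def)
next
  case one
  then show ?case
    using zero_in_Bq[where 'a='a, of "Suc 0"] Fq_1_in_Bq[where 'a='a] by (auto simp: bvec_def)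
next
  case (step n)
  have X: "X \<notin> Bq (Suc n)" "X \<notin> Aq (Suc n)"
    using step(4) by (auto simp: Bq_Suc[of "Suc n"])
  from step(3) consider \<beta> where "\<beta> \<in> Eq (Suc n)" "\<alpha> = \<beta> @ [Zero] \<or> \<alpha> = \<beta> @ [One]"
    | \<beta> \<chi> where "\<alpha> = \<beta> @ [Chi \<chi>]" "\<chi> \<in> Nq (Suc n)"
    by auto
  then show ?case
  proof cases
    case 1
    then show ?thesis
      using step(2)[OF 1(1) X(1)] X(2)
      by (auto simp: basis_vec_Zero basis_vec_One theta_outside fscale_def simp del: basis_vec.simps)
  next
    case 2
    then show ?thesis
      using X(2) by (simp add: basis_vec_Chi lam_outside del: basis_vec.simps)
  qed
qed

text \<open>A character entry counts once but raises the level by two; any other entry counts at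
  most once and raises it by one.\<close>

lemma Nnz_le: "\<alpha> \<in> Eq n \<Longrightarrow> Nnz \<alpha> \<le> n"
proof (induction n arbitrary: \<alpha> rule: induct_nat_012[case_names zero one step])
  case (step n)
  from step(3) consider \<beta> a where "\<beta> \<in> Eq (Suc n)" "\<alpha> = \<beta> @ [a]"
    | \<beta> \<chi> where "\<beta> \<in> Eq n" "\<alpha> = \<beta> @ [Chi \<chi>]"
    by auto
  then show ?case
  proof cases
    case 1
    then show ?thesis using step(2)[OF 1(1)] by (auto simp: Nnz_def)
  next
    case 2
    then show ?thesis using step(1)[OF 2(1)] by (auto simp: Nnz_def)
  qed
qed (auto simp: Nnz_def)

section \<open>Inner products of vectors with a given behaviour under \<open>Hgrp n\<close>\<close>

definition invariant_shape :: "nat \<Rightarrow> complex \<Rightarrow> complex \<Rightarrow> 'a::field comb \<Rightarrow> 'a comb \<Rightarrow> bool"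
  where "invariant_shape n c d v u \<longleftrightarrow> (\<forall>Z\<in>Bq n. u Z = c * v Z) \<and>
    (\<forall>Z\<in>Bq n. \<forall>a\<in>Fq n. u (lift n a Z) = d * v Z)"

text \<open>The two shapes describe how the coordinates on lifts depend on \<open>a\<close>: not at
  all for a last entry 0 or 1, through a character for \<open>Chi \<chi>\<close>. The conjugate is
  the one in \<open>pchi\<close>.\<close>

definition character_shape :: "nat \<Rightarrow> ('a::field mat \<Rightarrow> complex) \<Rightarrow> 'a comb \<Rightarrow> 'a comb \<Rightarrow> bool"
  where "character_shape n \<chi> v u \<longleftrightarrow> (\<forall>Z\<in>Bq n. u Z = 0) \<and>
    (\<forall>Z\<in>Bq n. \<forall>a\<in>Fq n. u (lift n a Z) = v Z * cnj (\<chi> (shear n a)))"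

lemma weighted_inner_invariant:
  fixes u u' :: "'a::{finite,field} comb"
  assumes "invariant_shape n c d v u" "invariant_shape n c' d' v' u'"
  shows "weighted_inner (Suc n) u u' =
    (cnj c * c' + of_nat CARD('a) ^ n * (cnj d * d')) * weighted_inner n v v'"
  unfolding weighted_inner_Suc using assms
  by (simp add: weighted_inner_def invariant_shape_def card_Fq sum_distrib_left
      algebra_simps flip: sum.distrib)

lemma sum_Nq:
  fixes \<chi> :: "'a::{finite,field} mat \<Rightarrow> complex"
  assumes "\<chi> \<in> Nq n"
  shows "(\<Sum>a\<in>Fq n. \<chi> (shear n a)) = 0"
proof -
  obtain a where "a \<in> Fq n" "\<chi> (shear n a) \<noteq> 1" using Nq_nontrivial[OF assms] .
  then show ?thesis
    using sum_char_on[OF add_subgroup_subspace[OF subspace_Fq] Nq_char[OF assms]] by blast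
qed

text \<open>The dependence on \<open>a\<close> is through \<open>\<chi>\<close> alone, and a
  nontrivial character sums to 0.\<close>

lemma weighted_inner_character_invariant:
  fixes u u' :: "'a::{finite,field} comb"
  assumes "character_shape n \<chi> v u" "invariant_shape n c d v' u'" "\<chi> \<in> Nq n"
  shows "weighted_inner (Suc n) u u' = 0"
proof -
  have "(\<Sum>a\<in>Fq n. cnj (u (lift n a Z)) * u' (lift n a Z)) = 0" if "Z \<in> Bq n" for Z
  proof -
    have "(\<Sum>a\<in>Fq n. cnj (u (lift n a Z)) * u' (lift n a Z)) =
        cnj (v Z) * d * v' Z * (\<Sum>a\<in>Fq n. \<chi> (shear n a))"
      using assms that
      by (simp add: character_shape_def invariant_shape_def sum_distrib_left mult_ac)
    then show ?thesis using assms(3) by (simp add: sum_Nq)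
  qed
  then show ?thesis
    using assms(1) unfolding weighted_inner_Suc by (simp add: weighted_inner_def character_shape_def)
qed

lemma weighted_inner_characters:
  fixes u u' :: "'a::{finite,field} comb"
  assumes u: "character_shape n \<chi> v u" "character_shape n \<chi>' v' u'"
    and \<chi>: "\<chi> \<in> Nq n" "\<chi>' \<in> Nq n"
  shows "weighted_inner (Suc n) u u' =
    (if \<chi> = \<chi>' then of_nat CARD('a) ^ n * weighted_inner n v v' else 0)"
proof -
  have F: "add_subgroup (Fq n :: 'a cvec set)"
    by (intro add_subgroup_subspace subspace_Fq)
  \<comment> \<open>The coordinates carry conjugated characters; conjugating those of
    \<open>u\<close> leaves the bar on \<open>\<chi>'\<close> only.\<close>
  have *: "(\<Sum>a\<in>Fq n. cnj (\<chi>' (shear n a)) * \<chi> (shear n a)) =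
      (if \<chi> = \<chi>' then of_nat CARD('a) ^ n else 0)"
  proof (cases "\<chi> = \<chi>'")
    case True
    then show ?thesis
      using cnj_mult_char_on[OF F finite_Fq Nq_char[OF \<chi>(1)]] by (simp add: card_Fq)
  next
    case False
    then obtain a where "a \<in> Fq n" "\<chi> (shear n a) \<noteq> \<chi>' (shear n a)"
      using Nq_separate[OF \<chi>] by blast
    then show ?thesis
      using char_on_orthogonal[OF F finite_Fq Nq_char[OF \<chi>(2)] Nq_char[OF \<chi>(1)], of a] False
      by auto
  qed
  have "(\<Sum>a\<in>Fq n. cnj (u (lift n a Z)) * u' (lift n a Z)) =
      (if \<chi> = \<chi>' then of_nat CARD('a) ^ n else 0) * (cnj (v Z) * v' Z)" if "Z \<in> Bq n" for Z
  proof -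
    have "(\<Sum>a\<in>Fq n. cnj (u (lift n a Z)) * u' (lift n a Z)) =
        (\<Sum>a\<in>Fq n. cnj (\<chi>' (shear n a)) * \<chi> (shear n a)) * (cnj (v Z) * v' Z)"
      using u that by (simp add: character_shape_def sum_distrib_left sum_distrib_right mult_ac)
    then show ?thesis by (simp only: *)
  qed
  then show ?thesis
    using u(1) unfolding weighted_inner_Suc
    by (simp add: weighted_inner_def character_shape_def sum_distrib_left mult.assoc)
qed

text \<open>\<open>mu\<close> moves coordinates along an injection of subspaces that preserves
  dimension, hence weight, and it is 0 off the image.\<close>

lemma weighted_inner_mu:
  fixes X :: "'a::{finite,field} cvec set"
  assumes X: "X \<in> Bq n" "fs.dim X = n - 1" "n > 0"
  shows "weighted_inner n (mu n X u) (mu n X v) = weighted_inner (n - 1) u v"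
proof -
  let ?q = "of_nat CARD('a) :: complex"
  let ?f = "\<lambda>Z. cnj (mu n X u Z) * mu n X v Z * ?q ^ (fs.dim Z choose 2)"
  let ?t = "(`) (tau n X)"
  have "?t ` Bq (n - 1) \<subseteq> Bq n"
    using tau_in_subspaces_of[OF X] subspaces_of_subset_Bq[OF X(1)] by blast
  then have "(\<Sum>Z\<in>Bq n. ?f Z) = (\<Sum>Z\<in>?t ` Bq (n - 1). ?f Z)"
    by (intro sum.mono_neutral_right finite_Bq) (simp_all add: mu_outside)
  also have "\<dots> = (\<Sum>Y\<in>Bq (n - 1). ?f (?t Y))"
    by (rule sum.reindex_cong[OF inj_on_image_tau[OF X]]) auto
  also have "\<dots> = (\<Sum>Y\<in>Bq (n - 1). cnj (u Y) * v Y * ?q ^ (fs.dim Y choose 2))"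
    by (intro sum.cong) (simp_all add: mu_tau[OF X] dim_tau[OF X])
  finally show ?thesis by (simp add: weighted_inner_def)
qed

section \<open>Shapes of the basis vectors and the induction over the level\<close>

lemma basis_vec_invariant_shape:
  fixes \<beta> :: "'a::{finite,field} entry list"
  assumes \<beta>: "\<beta> \<in> Eq (Suc n)"
  shows "invariant_shape (Suc n) (of_nat CARD('a) ^ Nnz \<beta>) 1
      (basis_vec (Suc n) \<beta>) (basis_vec (Suc (Suc n)) (\<beta> @ [Zero]))"
    and "invariant_shape (Suc n) (of_nat CARD('a) ^ (Suc n - Nnz \<beta>)) (- 1)
      (basis_vec (Suc n) \<beta>) (basis_vec (Suc (Suc n)) (\<beta> @ [One]))"
proof -
  \<comment> \<open>A lift lies outside \<open>Bq (Suc n)\<close>, so only \<open>theta\<close>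
    contributes there; inside, only the prefix vector does.\<close>
  have "basis_vec (Suc n) \<beta> (lift (Suc n) a Z) = 0" if "Z \<in> Bq (Suc n)" "a \<in> Fq (Suc n)" for a Z
    using lift_in_Aq[OF that] by (intro basis_vec_support \<beta>) (simp add: mem_Aq_iff)
  moreover have "theta (Suc n) (basis_vec (Suc n) \<beta>) Z = 0" if "Z \<in> Bq (Suc n)" for Z
    using that by (intro theta_outside) (simp add: mem_Aq_iff)
  ultimately show "invariant_shape (Suc n) (of_nat CARD('a) ^ Nnz \<beta>) 1
      (basis_vec (Suc n) \<beta>) (basis_vec (Suc (Suc n)) (\<beta> @ [Zero]))"
    and "invariant_shape (Suc n) (of_nat CARD('a) ^ (Suc n - Nnz \<beta>)) (- 1)
      (basis_vec (Suc n) \<beta>) (basis_vec (Suc (Suc n)) (\<beta> @ [One]))"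
    unfolding invariant_shape_def basis_vec_Zero basis_vec_One
    by (auto simp: theta_lift fscale_def)
qed

lemma basis_vec_character_shape:
  assumes "\<chi> \<in> Nq (Suc n)"
  shows "character_shape (Suc n) \<chi> (mu (Suc n) (Xchi (Suc n) \<chi>) (basis_vec n \<beta>))
    (basis_vec (Suc (Suc n)) (\<beta> @ [Chi \<chi>]))"
  unfolding character_shape_def basis_vec_Chi
  using assms by (auto simp: lam_mu_lift lam_outside mem_Aq_iff)

text \<open>Dimensions 0 and 1 both have weight 1, so \<open>{0}\<close> and \<open>Fq 1\<close>
  contribute 1 and -1.\<close>

lemma weighted_inner_1:
  "weighted_inner (Suc 0) (basis_vec (Suc 0) [Zero]) (basis_vec (Suc 0) [One :: 'a::{finite,field} entry]) = 0"
proof -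
  let ?F = "Fq (Suc 0) :: 'a cvec set"
  have neq: "?F \<noteq> {0}"
    using card_Fq[where 'a='a, of "Suc 0"] CARD_field_gt_1[where 'a='a] by auto
  have "fs.dim {0 :: 'a cvec} = 0"
    using dim_eqI[OF zero_in_Bq[of 0], of 0] by simp
  moreover have "fs.dim ?F = 1"
    using dim_eqI[OF Fq_1_in_Bq, of 1] by (simp add: card_Fq)
  ultimately have "cnj ((bvec {0} + bvec ?F) X) * (bvec {0} - bvec ?F) X *
      of_nat CARD('a) ^ (fs.dim X choose 2) =
      (if X = {0} then 1 else 0) - (if X = ?F then 1 else 0)" for X
    using neq by (auto simp: bvec_def numeral_2_eq_2)
  then show ?thesis
    using zero_in_Bq[where 'a='a, of "Suc 0"] Fq_1_in_Bq[where 'a='a]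
    by (simp add: weighted_inner_def sum_subtractf finite_Bq)
qed

text \<open>The induction reaches back two levels because the prefix before a character entry
  belongs to level \<open>n\<close> when the sequence belongs to level \<open>n + 2\<close>.\<close>

lemma weighted_inner_basis_vec:
  fixes \<alpha> \<beta> :: "'a::{finite,field} entry list"
  shows "\<alpha> \<in> Eq n \<Longrightarrow> \<beta> \<in> Eq n \<Longrightarrow> \<alpha> \<noteq> \<beta> \<Longrightarrow>
    weighted_inner n (basis_vec n \<alpha>) (basis_vec n \<beta>) = 0"
proof (induction n arbitrary: \<alpha> \<beta> rule: induct_nat_012[case_names zero one step])
  case zero
  then show ?case by simp
next
  case one
  then have "\<alpha> = [Zero] \<and> \<beta> = [One] \<or> \<alpha> = [One] \<and> \<beta> = [Zero]" by auto
  then show ?case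
    using weighted_inner_1[where 'a='a] weighted_inner_commute by (metis complex_cnj_zero)
next
  case (step n)
  let ?q = "of_nat CARD('a) :: complex"
  let ?b = "basis_vec (Suc (Suc n))"
  have split: "(\<exists>\<beta>\<in>Eq (Suc n). \<alpha> = \<beta> @ [Zero] \<or> \<alpha> = \<beta> @ [One]) \<or>
      (\<exists>\<beta>\<in>Eq n. \<exists>\<chi>\<in>Nq (Suc n). \<alpha> = \<beta> @ [Chi \<chi>])" if "\<alpha> \<in> Eq (Suc (Suc n))" for \<alpha> :: "'a entry list"
    using that by auto
  have shape: "\<exists>c d. invariant_shape (Suc n) c d (basis_vec (Suc n) \<gamma>) (?b \<alpha>)"
    if "\<gamma> \<in> Eq (Suc n)" "\<alpha> = \<gamma> @ [Zero] \<or> \<alpha> = \<gamma> @ [One]" for \<alpha> \<gamma>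
    using basis_vec_invariant_shape[OF that(1)] that(2) by blast
  have zero_one: "weighted_inner (Suc (Suc n)) (?b (\<gamma> @ [Zero])) (?b (\<gamma> @ [One])) = 0"
    if "\<gamma> \<in> Eq (Suc n)" for \<gamma> :: "'a entry list"
  proof -
    \<comment> \<open>With \<open>k = Nnz \<gamma>\<close> the factor in
      \<open>weighted_inner_invariant\<close> is
      \<open>q ^ k * q ^ (n + 1 - k) - q ^ (n + 1)\<close>; \<open>Nnz_le\<close> makes the exponent
      a true difference.\<close>
    have "?q ^ Nnz \<gamma> * ?q ^ (Suc n - Nnz \<gamma>) = ?q ^ Suc n"
      using Nnz_le[OF that] by (simp flip: power_add)
    then show ?thesis
      using weighted_inner_invariant[OF basis_vec_invariant_shape[OF that]] by simp
  qed
  \<comment> \<open>The letters give the kinds of the two last entries: i for 0 or 1, c for a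
    character.\<close>
  consider
    (ii) \<gamma> \<delta> where "\<gamma> \<in> Eq (Suc n)" "\<alpha> = \<gamma> @ [Zero] \<or> \<alpha> = \<gamma> @ [One]"
      "\<delta> \<in> Eq (Suc n)" "\<beta> = \<delta> @ [Zero] \<or> \<beta> = \<delta> @ [One]"
  | (ci) \<gamma> \<chi> \<delta> where "\<chi> \<in> Nq (Suc n)" "\<alpha> = \<gamma> @ [Chi \<chi>]"
      "\<delta> \<in> Eq (Suc n)" "\<beta> = \<delta> @ [Zero] \<or> \<beta> = \<delta> @ [One]"
  | (ic) \<gamma> \<chi> \<delta> where "\<delta> \<in> Eq (Suc n)" "\<alpha> = \<delta> @ [Zero] \<or> \<alpha> = \<delta> @ [One]"
      "\<chi> \<in> Nq (Suc n)" "\<beta> = \<gamma> @ [Chi \<chi>]"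
  | (cc) \<gamma> \<chi> \<delta> \<chi>' where "\<gamma> \<in> Eq n" "\<chi> \<in> Nq (Suc n)" "\<alpha> = \<gamma> @ [Chi \<chi>]"
      "\<delta> \<in> Eq n" "\<chi>' \<in> Nq (Suc n)" "\<beta> = \<delta> @ [Chi \<chi>']"
    using split[OF step(3)] split[OF step(4)] by metis
  then show ?case
  proof cases
    case ii
    show ?thesis
    proof (cases "\<gamma> = \<delta>")
      case True
      then have "\<alpha> = \<gamma> @ [Zero] \<and> \<beta> = \<gamma> @ [One] \<or> \<alpha> = \<gamma> @ [One] \<and> \<beta> = \<gamma> @ [Zero]"
        using ii step(5) by auto
      then show ?thesis
        using zero_one[OF ii(1)] weighted_inner_commute by (metis complex_cnj_zero)
    next
      case False
      obtain c d where u: "invariant_shape (Suc n) c d (basis_vec (Suc n) \<gamma>) (?b \<alpha>)"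
        using shape[OF ii(1,2)] by blast
      obtain c' d' where v: "invariant_shape (Suc n) c' d' (basis_vec (Suc n) \<delta>) (?b \<beta>)"
        using shape[OF ii(3,4)] by blast
      show ?thesis
        using weighted_inner_invariant[OF u v] step(2)[OF ii(1,3) False] by simp
    qed
  next
    case ci
    obtain c d where "invariant_shape (Suc n) c d (basis_vec (Suc n) \<delta>) (?b \<beta>)"
      using shape[OF ci(3,4)] by blast
    then show ?thesis
      using weighted_inner_character_invariant[OF basis_vec_character_shape] ci by blast
  next
    case ic
    obtain c d where "invariant_shape (Suc n) c d (basis_vec (Suc n) \<delta>) (?b \<alpha>)"
      using shape[OF ic(1,2)] by blast
    then have "weighted_inner (Suc (Suc n)) (?b \<beta>) (?b \<alpha>) = 0"
      using weighted_inner_character_invariant[OF basis_vec_character_shape] ic by blast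
    then show ?thesis
      using weighted_inner_commute by (metis complex_cnj_zero)
  next
    case cc
    note w = weighted_inner_characters[OF basis_vec_character_shape[OF cc(2)]
        basis_vec_character_shape[OF cc(5)] cc(2,5)]
    show ?thesis
    proof (cases "\<chi> = \<chi>'")
      case True
      \<comment> \<open>With equal characters the prefixes must differ, and
        \<open>weighted_inner_mu\<close> reduces level \<open>n + 1\<close> to their level
        \<open>n\<close>.\<close>
      then have "\<gamma> \<noteq> \<delta>" using cc step(5) by auto
      then show ?thesis
        using w[of \<gamma> \<delta>] weighted_inner_mu[OF Xchi(1,2)[OF cc(2)]] step(1)[OF cc(1,4)] True cc
        by simp
    next
      case False
      then show ?thesis using w[of \<gamma> \<delta>] cc by simp
    qed
  qed
qed

theorem theorem4p4:
  fixes n :: nat and \<alpha> \<beta> :: "'a::{finite,field} entry list"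
  assumes "\<alpha> \<in> Eq n" and "\<beta> \<in> Eq n" and "\<alpha> \<noteq> \<beta>"
  shows "inner_q n (basis_vec n \<alpha>) (basis_vec n \<beta>) = 0"
  using weighted_inner_basis_vec[OF assms] by (simp add: inner_q_eq)

end
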